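(* Let $\mathbf X=(X,\mathcal E)$ be a coarse space with decomposition $\mathbf X=\bigsqcup_{i\in I}\mathbf X_i$ in coarsely connected components, let $\mathcal H_{\mathbf X}$ be an $\mathbf X$-module, and suppose that $X_i\subseteq X$ is measurable for all $i\in I$. Put $\mathcal H_i=\mathbb 1_{X_i}(\mathcal H_{\mathbf X})$, and let $\mathcal R^*(\mathcal H_{\mathbf X})$ denote either of $C^*_{\mathrm{Roe}}(\mathcal H_{\mathbf X})$, $C^*_{\mathrm{cp}}(\mathcal H_{\mathbf X})$, or (when $\mathcal H_{\mathbf X}$ is admissible) $C^*_{\mathrm{ql}}(\mathcal H_{\mathbf X})$. Then $$\mathcal R^*(\mathcal H_{\mathbf X})\cap\mathcal K(\mathcal H_{\mathbf X})=\bigoplus_{i\in I}\mathcal K(\mathcal H_i).$$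
   Context: For relations $E,F\subseteq X\times X$: $E^T=\{(x,y):(y,x)\in E\}$, $E\circ F=\{(z,x):\exists y,(z,y)\in E,(y,x)\in F\}$, $E(A)=\{y:\exists a\in A,(y,a)\in E\}$; $B,A\subseteq X$ are $E$-separated if $B\cap E(A)=\emptyset$. A coarse structure on $X$ is a non-empty family $\mathcal E$ of subsets of $X\times X$, closed under subsets and finite unions, containing the diagonal $\Delta_X$, and closed under $E\mapsto E^T$ and composition. A gauge is a symmetric element of $\mathcal E$ containing $\Delta_X$. $A\subseteq X$ is $E$-bounded if $A\times A\subseteq E$, bounded if $A\times A\in\mathcal E$. A coarse space is coarsely connected if every finite subset is bounded. Subsets are coarsely disjoint if no bounded set meets both. The coarsely connected components are the unique partition $X=\bigsqcup_iX_i$ into pairwise coarsely disjoint sets such that the restriction of $\mathcal E$ to each $X_i$ makes it a coarsely connected coarse space $\mathbf X_i$. An $\mathbf X$-module consists of a Boolean algebra $\mathfrak A$ of subsets of $X$ with $X\in\mathfrak A$ (its members are called measurable), a Hilbert space $\mathcal H$, and a map $\mathbb 1_\bullet$ from $\mathfrak A$ to projections in $\mathcal B(\mathcal H)$ with $\mathbb 1_\emptyset=0$, $\mathbb 1_X=1$, $\mathbb 1_{A\cap B}=\mathbb 1_A\mathbb 1_B$, $\mathbb 1_{A\cup B}=\mathbb 1_A+\mathbb 1_B-\mathbb 1_A\mathbb 1_B$, non-degenerate in the sense that for some gauge $\widetilde E$ the subspaces $\mathbb 1_A(\mathcal H)$ with $A$ measurable and $\widetilde E$-bounded span a dense subspace.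 It is admissible if there is a gauge $\widetilde E$ such that for every $B\subseteq X$ there is a measurable $A$ with $B\subseteq A\subseteq\widetilde E(B)$. For $t\in\mathcal B(\mathcal H)$, $t$ has controlled propagation if for some $E\in\mathcal E$, $\mathbb 1_Bt\mathbb 1_A=0$ for all $E$-separated measurable $B,A$. $t$ is quasi-local if for every $\varepsilon>0$ there is $E\in\mathcal E$ with $\|\mathbb 1_{A'}t\mathbb 1_A\|\le\varepsilon$ for all $E$-separated measurable $A',A$. $t$ is locally compact if $\mathbb 1_At$ and $t\mathbb 1_A$ are compact for every bounded measurable $A$. $C^*_{\mathrm{cp}}(\mathcal H)$ is the norm closure of the operators of controlled propagation; $C^*_{\mathrm{Roe}}(\mathcal H)$ is the norm closure of the locally compact operators of controlled propagation; $C^*_{\mathrm{ql}}(\mathcal H)$ is the set of quasi-local operators. $\mathcal K$ denotes compact operators; $\bigoplus_i\mathcal K(\mathcal H_i)$ is the $C^*$-algebraic ($c_0$-)direct sum, viewed in $\prod_i\mathcal B(\mathcal H_i)\subseteq\mathcal B(\mathcal H_{\mathbf X})$ acting diagonally. *)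

theory Defs
  imports "HOL-Analysis.Analysis"
begin

section \<open>Complex Hilbert spaces and their operators\<close>

text \<open>
  The inner product is conjugate-linear in its first argument.  Positive semi-definiteness and
  definiteness of \<open>cinner\<close> follow from \<open>norm_eq_sqrt_cinner\<close>, since \<open>sqrt\<close> is negative on
  negative reals while \<open>norm\<close> is a (complete) norm by the superclass \<open>banach\<close>.
\<close>

class complex_hilbert_space = banach +
  fixes scaleC :: "complex \<Rightarrow> 'a \<Rightarrow> 'a" (infixr "*\<^sub>C" 75)
    and cinner :: "'a \<Rightarrow> 'a \<Rightarrow> complex"
  assumes scaleC_add_right: "c *\<^sub>C (x + y) = c *\<^sub>C x + c *\<^sub>C y"
    and scaleC_add_left: "(c + d) *\<^sub>C x = c *\<^sub>C x + d *\<^sub>C x"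
    and scaleC_scaleC: "c *\<^sub>C d *\<^sub>C x = (c * d) *\<^sub>C x"
    and scaleC_of_real: "complex_of_real r *\<^sub>C x = r *\<^sub>R x"
    and cinner_commute: "cinner x y = cnj (cinner y x)"
    and cinner_add_right: "cinner x (y + z) = cinner x y + cinner x z"
    and cinner_scaleC_right: "cinner x (c *\<^sub>C y) = c * cinner x y"
    and norm_eq_sqrt_cinner: "norm x = sqrt (Re (cinner x x))"

instantiation complex :: complex_hilbert_space
begin

definition scaleC_complex :: "complex \<Rightarrow> complex \<Rightarrow> complex" where
  "scaleC_complex c x = c * x"

definition cinner_complex :: "complex \<Rightarrow> complex \<Rightarrow> complex" where
  "cinner_complex x y = cnj x * y"

instance
  by standard
    (simp_all add: scaleC_complex_def cinner_complex_def algebra_simps scaleR_conv_of_real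
      cmod_def power2_eq_square)

end

global_interpretation complex_vector:
  vector_space "scaleC :: complex \<Rightarrow> 'h \<Rightarrow> 'h::complex_hilbert_space"
  defines cspan = complex_vector.span
  by standard
    (simp_all add: scaleC_add_right scaleC_add_left scaleC_scaleC
      scaleC_of_real[of 1, simplified])

text \<open>
  The library type of bounded operators consists of the real-linear ones, so complex linearity
  is imposed separately; the operator norm and its topology are unaffected.
\<close>

definition bounded_operators :: "('h::complex_hilbert_space \<Rightarrow>\<^sub>L 'h) set" where
  "bounded_operators = {t :: 'h \<Rightarrow>\<^sub>L 'h. \<forall>c x. t (c *\<^sub>C x) = c *\<^sub>C t x}"

definition is_projection :: "('h::complex_hilbert_space \<Rightarrow>\<^sub>L 'h) \<Rightarrow> bool" where
  "is_projection p \<longleftrightarrow>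
     p \<in> bounded_operators \<and> p o\<^sub>L p = p \<and> (\<forall>x y. cinner (p x) y = cinner x (p y))"

text \<open>
  Operators on a closed subspace \<open>S\<close> are represented by functions on the ambient space of which
  only the values on \<open>S\<close> matter.
\<close>

definition compact_operators_on :: "'h::complex_hilbert_space set \<Rightarrow> ('h \<Rightarrow> 'h) set" where
  "compact_operators_on S =
     {f. f ` S \<subseteq> S
       \<and> (\<forall>x\<in>S. \<forall>y\<in>S. f (x + y) = f x + f y)
       \<and> (\<forall>c. \<forall>x\<in>S. f (c *\<^sub>C x) = c *\<^sub>C f x)
       \<and> compact (closure (f ` (S \<inter> cball 0 1)))}"

definition operator_norm_on :: "'h::complex_hilbert_space set \<Rightarrow> ('h \<Rightarrow> 'h) \<Rightarrow> real" where
  "operator_norm_on S f = (SUP x\<in>S \<inter> cball 0 1. norm (f x))"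

definition compact_operators :: "('h::complex_hilbert_space \<Rightarrow>\<^sub>L 'h) set" where
  "compact_operators = {t \<in> bounded_operators. blinfun_apply t \<in> compact_operators_on UNIV}"

definition c0_sum_compacts ::
  "'i set \<Rightarrow> ('i \<Rightarrow> 'h::complex_hilbert_space set) \<Rightarrow> ('i \<Rightarrow> 'h \<Rightarrow> 'h) set" where
  "c0_sum_compacts I S =
     {s. (\<forall>i\<in>I. s i \<in> compact_operators_on (S i))
       \<and> (\<forall>\<epsilon>>0. finite {i \<in> I. \<epsilon> \<le> operator_norm_on (S i) (s i)})}"

text \<open>
  For projections \<open>p i\<close> onto mutually orthogonal subspaces with dense span, the ambient space is
  the Hilbert sum of the ranges of the \<open>p i\<close>, and \<open>p i x\<close> is the \<open>i\<close>-th component of \<open>x\<close>.  The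
  set below then consists of the operators \<open>(x\<^sub>i)\<^sub>i \<mapsto> (s\<^sub>i x\<^sub>i)\<^sub>i\<close> with \<open>s\<close> in the direct sum.
\<close>

definition diagonal_c0_sum_compacts ::
  "'i set \<Rightarrow> ('i \<Rightarrow> 'h::complex_hilbert_space \<Rightarrow>\<^sub>L 'h) \<Rightarrow> ('h \<Rightarrow>\<^sub>L 'h) set" where
  "diagonal_c0_sum_compacts I p =
     {t \<in> bounded_operators. \<exists>s \<in> c0_sum_compacts I (\<lambda>i. range (p i)).
        \<forall>x. \<forall>i\<in>I. p i (t x) = s i (p i x)}"


section \<open>Coarse spaces\<close>

text \<open>
  Transposition and composition of relations are the library's \<open>E\<inverse>\<close> and \<open>E O F\<close>.  The
  neighbourhood \<open>E(A)\<close>, however, is the preimage \<open>E\<inverse> `` A\<close> and not \<open>E `` A\<close>.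
\<close>

definition nbhd :: "('x \<times> 'x) set \<Rightarrow> 'x set \<Rightarrow> 'x set" where
  "nbhd E A = {y. \<exists>a\<in>A. (y, a) \<in> E}"

definition separated :: "('x \<times> 'x) set \<Rightarrow> 'x set \<Rightarrow> 'x set \<Rightarrow> bool" where
  "separated E B A \<longleftrightarrow> B \<inter> nbhd E A = {}"

locale coarse_space =
  fixes X :: "'x set" and \<E> :: "('x \<times> 'x) set set"
  assumes entourage_subset: "E \<in> \<E> \<Longrightarrow> E \<subseteq> X \<times> X"
    and nonempty: "\<E> \<noteq> {}"
    and subset_closed: "E \<in> \<E> \<Longrightarrow> F \<subseteq> E \<Longrightarrow> F \<in> \<E>"
    and union_closed: "E \<in> \<E> \<Longrightarrow> F \<in> \<E> \<Longrightarrow> E \<union> F \<in> \<E>"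
    and diagonal: "Id_on X \<in> \<E>"
    and transpose_closed: "E \<in> \<E> \<Longrightarrow> E\<inverse> \<in> \<E>"
    and comp_closed: "E \<in> \<E> \<Longrightarrow> F \<in> \<E> \<Longrightarrow> E O F \<in> \<E>"

definition gauge_of :: "'x set \<Rightarrow> ('x \<times> 'x) set set \<Rightarrow> ('x \<times> 'x) set \<Rightarrow> bool" where
  "gauge_of X \<E> E \<longleftrightarrow> E \<in> \<E> \<and> sym E \<and> Id_on X \<subseteq> E"

definition coarse_bounded :: "('x \<times> 'x) set set \<Rightarrow> 'x set \<Rightarrow> bool" where
  "coarse_bounded \<E> A \<longleftrightarrow> A \<times> A \<in> \<E>"

definition coarsely_connected :: "'x set \<Rightarrow> ('x \<times> 'x) set set \<Rightarrow> bool" where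
  "coarsely_connected X \<E> \<longleftrightarrow> (\<forall>A\<subseteq>X. finite A \<longrightarrow> coarse_bounded \<E> A)"

definition coarsely_disjoint :: "('x \<times> 'x) set set \<Rightarrow> 'x set \<Rightarrow> 'x set \<Rightarrow> bool" where
  "coarsely_disjoint \<E> A B \<longleftrightarrow> \<not> (\<exists>C. coarse_bounded \<E> C \<and> C \<inter> A \<noteq> {} \<and> C \<inter> B \<noteq> {})"

definition restrict_coarse :: "('x \<times> 'x) set set \<Rightarrow> 'x set \<Rightarrow> ('x \<times> 'x) set set" where
  "restrict_coarse \<E> Y = {E \<in> \<E>. E \<subseteq> Y \<times> Y}"

definition coarse_components ::
  "'x set \<Rightarrow> ('x \<times> 'x) set set \<Rightarrow> 'i set \<Rightarrow> ('i \<Rightarrow> 'x set) \<Rightarrow> bool" where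
  "coarse_components X \<E> I Xc \<longleftrightarrow>
     (\<Union>i\<in>I. Xc i) = X
     \<and> (\<forall>i\<in>I. Xc i \<noteq> {})
     \<and> disjoint_family_on Xc I
     \<and> (\<forall>i\<in>I. \<forall>j\<in>I. i \<noteq> j \<longrightarrow> coarsely_disjoint \<E> (Xc i) (Xc j))
     \<and> (\<forall>i\<in>I. coarse_space (Xc i) (restrict_coarse \<E> (Xc i))
            \<and> coarsely_connected (Xc i) (restrict_coarse \<E> (Xc i)))"


section \<open>Modules over coarse spaces and their operator algebras\<close>

locale coarse_module = coarse_space X \<E> + algebra X \<AA>
  for X :: "'x set" and \<E> :: "('x \<times> 'x) set set" and \<AA> :: "'x set set" +
  fixes p :: "'x set \<Rightarrow> 'h::complex_hilbert_space \<Rightarrow>\<^sub>L 'h"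
  assumes projection: "A \<in> \<AA> \<Longrightarrow> is_projection (p A)"
    and proj_empty: "p {} = 0"
    and proj_space: "p X = id_blinfun"
    and proj_Int: "A \<in> \<AA> \<Longrightarrow> B \<in> \<AA> \<Longrightarrow> p (A \<inter> B) = p A o\<^sub>L p B"
    and proj_Un: "A \<in> \<AA> \<Longrightarrow> B \<in> \<AA> \<Longrightarrow> p (A \<union> B) = p A + p B - (p A o\<^sub>L p B)"
    and nondegenerate:
      "\<exists>E. gauge_of X \<E> E \<and> closure (cspan (\<Union>A\<in>{A \<in> \<AA>. A \<times> A \<subseteq> E}. range (p A))) = UNIV"

definition admissible :: "'x set \<Rightarrow> ('x \<times> 'x) set set \<Rightarrow> 'x set set \<Rightarrow> bool" where
  "admissible X \<E> \<AA> \<longleftrightarrow>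
     (\<exists>E. gauge_of X \<E> E \<and> (\<forall>B\<subseteq>X. \<exists>A\<in>\<AA>. B \<subseteq> A \<and> A \<subseteq> nbhd E B))"

definition controlled_propagation ::
  "('x \<times> 'x) set set \<Rightarrow> 'x set set \<Rightarrow> ('x set \<Rightarrow> 'h::complex_hilbert_space \<Rightarrow>\<^sub>L 'h)
    \<Rightarrow> ('h \<Rightarrow>\<^sub>L 'h) \<Rightarrow> bool" where
  "controlled_propagation \<E> \<AA> p t \<longleftrightarrow>
     (\<exists>E\<in>\<E>. \<forall>B\<in>\<AA>. \<forall>A\<in>\<AA>. separated E B A \<longrightarrow> p B o\<^sub>L t o\<^sub>L p A = 0)"

definition quasi_local ::
  "('x \<times> 'x) set set \<Rightarrow> 'x set set \<Rightarrow> ('x set \<Rightarrow> 'h::complex_hilbert_space \<Rightarrow>\<^sub>L 'h)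
    \<Rightarrow> ('h \<Rightarrow>\<^sub>L 'h) \<Rightarrow> bool" where
  "quasi_local \<E> \<AA> p t \<longleftrightarrow>
     (\<forall>\<epsilon>>0. \<exists>E\<in>\<E>. \<forall>B\<in>\<AA>. \<forall>A\<in>\<AA>. separated E B A \<longrightarrow> norm (p B o\<^sub>L t o\<^sub>L p A) \<le> \<epsilon>)"

definition locally_compact_operator ::
  "('x \<times> 'x) set set \<Rightarrow> 'x set set \<Rightarrow> ('x set \<Rightarrow> 'h::complex_hilbert_space \<Rightarrow>\<^sub>L 'h)
    \<Rightarrow> ('h \<Rightarrow>\<^sub>L 'h) \<Rightarrow> bool" where
  "locally_compact_operator \<E> \<AA> p t \<longleftrightarrow>
     (\<forall>A\<in>\<AA>. coarse_bounded \<E> A \<longrightarrow>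
        p A o\<^sub>L t \<in> compact_operators \<and> t o\<^sub>L p A \<in> compact_operators)"

definition C_cp ::
  "('x \<times> 'x) set set \<Rightarrow> 'x set set \<Rightarrow> ('x set \<Rightarrow> 'h::complex_hilbert_space \<Rightarrow>\<^sub>L 'h)
    \<Rightarrow> ('h \<Rightarrow>\<^sub>L 'h) set" where
  "C_cp \<E> \<AA> p = closure {t \<in> bounded_operators. controlled_propagation \<E> \<AA> p t}"

definition C_Roe ::
  "('x \<times> 'x) set set \<Rightarrow> 'x set set \<Rightarrow> ('x set \<Rightarrow> 'h::complex_hilbert_space \<Rightarrow>\<^sub>L 'h)
    \<Rightarrow> ('h \<Rightarrow>\<^sub>L 'h) set" where
  "C_Roe \<E> \<AA> p =
     closure {t \<in> bounded_operators.
       controlled_propagation \<E> \<AA> p t \<and> locally_compact_operator \<E> \<AA> p t}"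

definition C_ql ::
  "('x \<times> 'x) set set \<Rightarrow> 'x set set \<Rightarrow> ('x set \<Rightarrow> 'h::complex_hilbert_space \<Rightarrow>\<^sub>L 'h)
    \<Rightarrow> ('h \<Rightarrow>\<^sub>L 'h) set" where
  "C_ql \<E> \<AA> p = {t \<in> bounded_operators. quasi_local \<E> \<AA> p t}"

end

theory Submission
  imports Defs
begin

text \<open>
  Finite unions of bounded sets give projections that converge strongly to the identity, and
  compressing a compact operator by them converges in norm.  A quasi-local operator \<open>t\<close> commutes
  with the projections \<open>p\<^sub>i\<close> of the components, because each component is separated from its
  complement for every entourage; if \<open>t\<close> is compact, then up to \<open>\<epsilon>\<close> it lives on a set that meets
  only finitely many components, so that \<open>p\<^sub>i t\<close> tends to \<open>0\<close>.  Conversely, an element of the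
  direct sum is a norm limit of finite sums of the \<open>p\<^sub>i t\<close>, each of which is a norm limit of
  compressions to bounded sets, and these have controlled propagation.  Since
  \<open>C_Roe \<subseteq> C_cp \<subseteq> C_ql\<close>, these two inclusions suffice for all three algebras.
\<close>


section \<open>Hilbert space geometry\<close>

lemma cinner_add_left:
  fixes x y z :: "'h::complex_hilbert_space"
  shows "cinner (x + y) z = cinner x z + cinner y z"
  by (metis cinner_add_right cinner_commute complex_cnj_add)

lemma norm_power2_eq_cinner:
  fixes x :: "'h::complex_hilbert_space"
  shows "(norm x)\<^sup>2 = Re (cinner x x)"
proof -
  \<comment> \<open>The value of \<open>sqrt\<close> on negative arguments matters: it is negative
    there, so a nonnegative norm forces \<open>Re (cinner x x)\<close> to be nonnegative, and
    squaring undoes the root.\<close>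
  have "0 \<le> sqrt (Re (cinner x x))"
    by (metis norm_eq_sqrt_cinner norm_ge_zero)
  then show ?thesis
    by (simp add: norm_eq_sqrt_cinner)
qed

lemma norm_add_power2:
  fixes x y :: "'h::complex_hilbert_space"
  shows "(norm (x + y))\<^sup>2 = (norm x)\<^sup>2 + (norm y)\<^sup>2 + 2 * Re (cinner x y)"
proof -
  have "Re (cinner y x) = Re (cinner x y)"
    by (subst cinner_commute) simp
  then show ?thesis
    by (simp add: norm_power2_eq_cinner cinner_add_left cinner_add_right)
qed

lemma cinner_scaleR_right:
  fixes x y :: "'h::complex_hilbert_space"
  shows "cinner x (r *\<^sub>R y) = of_real r * cinner x y"
  by (metis cinner_scaleC_right scaleC_of_real)

lemma cinner_minus_right:
  fixes x y :: "'h::complex_hilbert_space"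
  shows "cinner x (- y) = - cinner x y"
  using cinner_scaleR_right[of x "-1" y] by simp

text \<open>Cauchy-Schwarz can be read off from the triangle inequality, since \<open>norm\<close>
  is already known to be a norm: expand the squares of both sides and compare the mixed
  terms.\<close>

lemma Re_cinner_le:
  fixes x y :: "'h::complex_hilbert_space"
  shows "Re (cinner x y) \<le> norm x * norm y"
proof -
  have "(norm (x + y))\<^sup>2 \<le> (norm x + norm y)\<^sup>2"
    by (simp add: norm_triangle_ineq power_mono)
  then show ?thesis
    unfolding norm_add_power2 by (simp add: power2_sum)
qed

lemma abs_Re_cinner_le:
  fixes x y :: "'h::complex_hilbert_space"
  shows "\<bar>Re (cinner x y)\<bar> \<le> norm x * norm y"
  using Re_cinner_le[of x y] Re_cinner_le[of x "- y"] by (simp add: cinner_minus_right)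

lemma bounded_linear_Re_cinner:
  fixes y :: "'h::complex_hilbert_space"
  shows "bounded_linear (\<lambda>x. Re (cinner y x))"
proof (rule bounded_linear_intro)
  show "norm (Re (cinner y x)) \<le> norm x * norm y" for x
    using abs_Re_cinner_le[of y x] by (simp add: mult.commute)
qed (simp_all add: cinner_add_right cinner_scaleR_right)

section \<open>Complex-linear bounded operators\<close>

lemma bounded_operators_iff:
  "t \<in> bounded_operators \<longleftrightarrow> (\<forall>c x. t (c *\<^sub>C x) = c *\<^sub>C t x)"
  by (simp add: bounded_operators_def)

lemma bounded_operators_compose:
  "s \<in> bounded_operators \<Longrightarrow> t \<in> bounded_operators \<Longrightarrow> s o\<^sub>L t \<in> bounded_operators"
  by (simp add: bounded_operators_iff)

lemma bounded_operators_add: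
  "s \<in> bounded_operators \<Longrightarrow> t \<in> bounded_operators \<Longrightarrow> s + t \<in> bounded_operators"
  by (simp add: bounded_operators_iff blinfun.add_left scaleC_add_right)

lemma bounded_operators_zero: "0 \<in> bounded_operators"
  by (simp add: bounded_operators_iff)

text \<open>The norm is given as homogeneous for real scalars only; the bound \<open>cmod c\<close>
  for complex ones comes from the inner product. The resulting continuity makes complex linearity a
  closed condition on operators.\<close>

lemma bounded_linear_scaleC:
  "bounded_linear (\<lambda>x :: 'h::complex_hilbert_space. c *\<^sub>C x)"
proof (rule bounded_linear_intro)
  fix x y :: 'h and r :: real
  show "c *\<^sub>C (x + y) = c *\<^sub>C x + c *\<^sub>C y"
    by (rule scaleC_add_right)
  show "c *\<^sub>C (r *\<^sub>R x) = r *\<^sub>R (c *\<^sub>C x)"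
    by (metis scaleC_of_real scaleC_scaleC mult.commute)
  have "cinner (c *\<^sub>C x) (c *\<^sub>C x) = (c * cnj c) * cinner x x"
    unfolding cinner_scaleC_right by (subst cinner_commute)
      (simp add: cinner_scaleC_right cinner_commute[of x x, symmetric])
  also have "c * cnj c = of_real ((cmod c)\<^sup>2)"
    by (rule complex_norm_square[symmetric])
  finally have "(norm (c *\<^sub>C x))\<^sup>2 = (norm x * cmod c)\<^sup>2"
    by (simp add: norm_power2_eq_cinner power_mult_distrib del: of_real_power)
  then have "norm (c *\<^sub>C x) = norm x * cmod c"
    by (subst (asm) power2_eq_iff_nonneg) auto
  then show "norm (c *\<^sub>C x) \<le> norm x * cmod c"
    by simp
qed

lemma closed_bounded_operators:
  "closed (bounded_operators :: ('h::complex_hilbert_space \<Rightarrow>\<^sub>L 'h) set)"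
proof -
  have eval: "continuous_on UNIV (\<lambda>t :: 'h \<Rightarrow>\<^sub>L 'h. t x)" for x
    by (rule linear_continuous_on[OF blinfun.bounded_linear_left])
  have "closed {t :: 'h \<Rightarrow>\<^sub>L 'h. t (c *\<^sub>C x) = c *\<^sub>C t x}" for c x
    by (rule closed_Collect_eq[OF eval bounded_linear.continuous_on[OF bounded_linear_scaleC eval]])
  then show ?thesis
    unfolding bounded_operators_def by (intro closed_Collect_all)
qed


section \<open>Projections\<close>

lemma is_projection_idem: "is_projection q \<Longrightarrow> q (q x) = q x"
  using blinfun_apply_blinfun_compose[of q q x] by (simp add: is_projection_def)

lemma is_projection_range: "is_projection q \<Longrightarrow> v \<in> range q \<longleftrightarrow> q v = v"
  by (auto simp: is_projection_idem intro: range_eqI[OF sym])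

lemma is_projection_orthogonal:
  assumes "is_projection q" "q x = x" "q y = 0"
  shows "cinner x y = 0"
proof -
  have "cinner x y = cinner x (q y)"
    using assms unfolding is_projection_def by metis
  then show ?thesis
    using assms cinner_scaleR_right[of x 0] by simp
qed

lemma is_projection_pythagoras:
  assumes "is_projection q" "q x = x" "q y = 0"
  shows "(norm (x + y))\<^sup>2 = (norm x)\<^sup>2 + (norm y)\<^sup>2"
  by (simp add: norm_add_power2 is_projection_orthogonal[OF assms])

lemma is_projection_norm_le:
  assumes "is_projection q"
  shows "norm (q x) \<le> norm x" and "norm (x - q x) \<le> norm x"
proof -
  have "(norm (q x + (x - q x)))\<^sup>2 = (norm (q x))\<^sup>2 + (norm (x - q x))\<^sup>2"
    by (rule is_projection_pythagoras[OF assms])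
      (simp_all add: is_projection_idem[OF assms] blinfun.diff_right)
  then have "(norm (q x))\<^sup>2 \<le> (norm x)\<^sup>2" "(norm (x - q x))\<^sup>2 \<le> (norm x)\<^sup>2"
    by simp_all
  then show "norm (q x) \<le> norm x" and "norm (x - q x) \<le> norm x"
    by (simp_all add: power2_le_iff_abs_le)
qed

lemma norm_projection_le: "is_projection q \<Longrightarrow> norm q \<le> 1"
  by (rule norm_blinfun_bound) (simp_all add: is_projection_norm_le)

text \<open>
  Evaluating \<open>f\<close> at \<open>f u *\<^sub>R u + f v *\<^sub>R v\<close>, whose squared norm is at most
  \<open>(f u)\<^sup>2 + (f v)\<^sup>2\<close>, avoids the Riesz representation theorem.
\<close>

lemma functional_pythagoras:
  fixes f :: "'h::complex_hilbert_space \<Rightarrow> real"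
  assumes f: "bounded_linear f" and q: "is_projection q"
    and u: "q u = u" "norm u \<le> 1" and v: "q v = 0" "norm v \<le> 1"
  shows "(f u)\<^sup>2 + (f v)\<^sup>2 \<le> (onorm f)\<^sup>2"
proof -
  define S where "S = (f u)\<^sup>2 + (f v)\<^sup>2"
  define x where "x = f u *\<^sub>R u + f v *\<^sub>R v"
  interpret f: bounded_linear f by (rule f)
  have "f x = S"
    by (simp add: x_def S_def f.add f.scaleR power2_eq_square)
  then have "S \<le> onorm f * norm x"
    using onorm[OF f, of x] by simp
  moreover have "(norm x)\<^sup>2 \<le> S"
  proof -
    have "(norm x)\<^sup>2 = (norm (f u *\<^sub>R u))\<^sup>2 + (norm (f v *\<^sub>R v))\<^sup>2"
      unfolding x_def
      by (rule is_projection_pythagoras[OF q]) (simp_all add: blinfun.scaleR_right u v)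
    also have "\<dots> = (f u)\<^sup>2 * (norm u)\<^sup>2 + (f v)\<^sup>2 * (norm v)\<^sup>2"
      by (simp add: power_mult_distrib)
    also have "\<dots> \<le> (f u)\<^sup>2 * 1 + (f v)\<^sup>2 * 1"
      using u v by (intro add_mono mult_left_mono) (simp_all add: power_le_one)
    finally show ?thesis
      by (simp add: S_def)
  qed
  ultimately have "S\<^sup>2 \<le> (onorm f)\<^sup>2 * S"
  proof -
    assume a: "S \<le> onorm f * norm x" and b: "(norm x)\<^sup>2 \<le> S"
    have "0 \<le> S" by (simp add: S_def)
    then have "S\<^sup>2 \<le> (onorm f * norm x)\<^sup>2"
      using a by (simp add: power_mono)
    also have "\<dots> \<le> (onorm f)\<^sup>2 * S"
      using b by (simp add: power_mult_distrib mult_left_mono)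
    finally show ?thesis .
  qed
  then have "S \<le> (onorm f)\<^sup>2 \<or> S \<le> 0"
    by (auto simp: power2_eq_square)
  moreover have "0 \<le> (onorm f)\<^sup>2" by simp
  ultimately show ?thesis
    unfolding S_def[symmetric] by linarith
qed


section \<open>Compact operators\<close>

text \<open>This is the finite-net form in which compactness of operators is exploited below. The
  radius is halved because a finite union of closed balls is closed and therefore absorbs the
  closure.\<close>

lemma compact_closure_iff_totally_bounded:
  fixes S :: "'a::complete_space set"
  shows "compact (closure S) \<longleftrightarrow> (\<forall>e>0. \<exists>k. finite k \<and> S \<subseteq> (\<Union>x\<in>k. ball x e))"
proof
  assume "compact (closure S)"
  then show "\<forall>e>0. \<exists>k. finite k \<and> S \<subseteq> (\<Union>x\<in>k. ball x e)"
    unfolding compact_eq_totally_bounded using closure_subset by (meson subset_trans)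
next
  assume R: "\<forall>e>0. \<exists>k. finite k \<and> S \<subseteq> (\<Union>x\<in>k. ball x e)"
  have "\<exists>k. finite k \<and> closure S \<subseteq> (\<Union>x\<in>k. ball x e)" if "e > 0" for e
  proof -
    obtain k where k: "finite k" "S \<subseteq> (\<Union>x\<in>k. ball x (e/2))"
      using R \<open>e > 0\<close> by (meson half_gt_zero)
    have "closure S \<subseteq> (\<Union>x\<in>k. cball x (e/2))"
      using k by (intro closure_minimal) (auto intro!: closed_UN simp: mem_ball less_imp_le subset_iff, force)
    also have "\<dots> \<subseteq> (\<Union>x\<in>k. ball x e)"
      using \<open>e > 0\<close> by force
    finally show ?thesis
      using k by blast
  qed
  then show "compact (closure S)"
    unfolding compact_eq_totally_bounded by (simp add: complete_eq_closed)
qed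

lemma compact_closure_subset:
  fixes S :: "'a::t2_space set"
  shows "compact K \<Longrightarrow> S \<subseteq> K \<Longrightarrow> compact (closure S)"
  using compact_Int_closed[of K "closure S"] closure_minimal[of S K]
  by (simp add: compact_imp_closed inf.absorb2)

lemma compact_operators_iff:
  "t \<in> compact_operators \<longleftrightarrow> t \<in> bounded_operators \<and> compact (closure (t ` cball 0 1))"
  by (auto simp: compact_operators_def compact_operators_on_def bounded_operators_def
      blinfun.add_right)

lemma compact_operators_bounded: "t \<in> compact_operators \<Longrightarrow> t \<in> bounded_operators"
  by (simp add: compact_operators_iff)

lemma compact_operators_zero: "0 \<in> compact_operators"
  by (auto simp: compact_operators_iff bounded_operators_zero
      intro: compact_closure_subset[of "{0}"])

lemma compact_operators_compose_left:
  assumes "s \<in> bounded_operators" "t \<in> compact_operators"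
  shows "s o\<^sub>L t \<in> compact_operators"
proof -
  have "compact (s ` closure (t ` cball 0 1))"
    using assms by (intro compact_continuous_image continuous_intros)
      (simp add: compact_operators_iff)
  moreover have "(s o\<^sub>L t) ` cball 0 1 \<subseteq> s ` closure (t ` cball 0 1)"
    using closure_subset by force
  ultimately show ?thesis
    using assms compact_closure_subset
    by (auto simp: compact_operators_iff bounded_operators_compose)
qed

lemma compact_operators_compose_right:
  assumes "s \<in> bounded_operators" "t \<in> compact_operators"
  shows "t o\<^sub>L s \<in> compact_operators"
proof -
  \<comment> \<open>The image of the unit ball under \<open>s\<close> lies in the ball of radius
    \<open>r\<close>; adding 1 keeps \<open>r\<close> invertible even when \<open>s\<close> is
    zero.\<close>
  define r where "r = norm s + 1"
  have "r > 0" by (simp add: r_def add_nonneg_pos)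
  have "compact ((\<lambda>x. r *\<^sub>R x) ` closure (t ` cball 0 1))"
    using assms by (intro compact_scaling) (simp add: compact_operators_iff)
  moreover have "(t o\<^sub>L s) ` cball 0 1 \<subseteq> (\<lambda>x. r *\<^sub>R x) ` closure (t ` cball 0 1)"
  proof safe
    fix x :: 'a assume "x \<in> cball 0 1"
    then have "norm (s x) \<le> norm s"
      using norm_blinfun[of s x] by (simp add: mult_left_le order_trans)
    then have "inverse r *\<^sub>R s x \<in> cball 0 1"
      using \<open>r > 0\<close> by (simp add: r_def field_simps)
    moreover have "(t o\<^sub>L s) x = r *\<^sub>R t (inverse r *\<^sub>R s x)"
      using \<open>r > 0\<close> by (simp add: blinfun.scaleR_right)
    ultimately show "(t o\<^sub>L s) x \<in> (\<lambda>x. r *\<^sub>R x) ` closure (t ` cball 0 1)"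
      by (simp only:) (intro imageI subsetD[OF closure_subset])
  qed
  ultimately show ?thesis
    using assms compact_closure_subset
    by (auto simp: compact_operators_iff bounded_operators_compose)
qed

lemma compact_operators_add:
  assumes "s \<in> compact_operators" "t \<in> compact_operators"
  shows "s + t \<in> compact_operators"
proof -
  let ?S = "closure (s ` cball 0 1)" and ?T = "closure (t ` cball 0 1)"
  have "compact {x + y | x y. x \<in> ?S \<and> y \<in> ?T}"
    using assms by (intro compact_sums) (simp_all add: compact_operators_iff)
  moreover have "(s + t) ` cball 0 1 \<subseteq> {x + y | x y. x \<in> ?S \<and> y \<in> ?T}"
  proof
    fix z assume "z \<in> (s + t) ` cball 0 1"
    then obtain x where x: "x \<in> cball 0 1" "z = s x + t x"
      by (auto simp: blinfun.add_left)
    then have "s x \<in> ?S" "t x \<in> ?T"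
      by (simp_all add: subsetD[OF closure_subset])
    with x show "z \<in> {x + y | x y. x \<in> ?S \<and> y \<in> ?T}" by blast
  qed
  ultimately show ?thesis
    using assms compact_closure_subset
    by (auto simp: compact_operators_iff bounded_operators_add)
qed

text \<open>If \<open>s\<close> is within \<open>e/2\<close> of \<open>t\<close>, an
  \<open>e/2\<close>-net for the image of the unit ball under \<open>s\<close> is an
  \<open>e\<close>-net for its image under \<open>t\<close>.\<close>

lemma closed_compact_operators: "closed (compact_operators :: ('h::complex_hilbert_space \<Rightarrow>\<^sub>L 'h) set)"
  unfolding closure_subset_eq[symmetric]
proof
  fix t :: "'h \<Rightarrow>\<^sub>L 'h"
  assume t: "t \<in> closure compact_operators"
  have "t \<in> bounded_operators"
    using closure_minimal[OF _ closed_bounded_operators] t compact_operators_bounded by blast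
  moreover have "\<exists>k. finite k \<and> t ` cball 0 1 \<subseteq> (\<Union>x\<in>k. ball x e)" if "e > 0" for e
  proof -
    obtain s where s: "s \<in> compact_operators" "dist s t < e/2"
      using t \<open>e > 0\<close> closure_approachable by (metis half_gt_zero)
    obtain k where k: "finite k" "s ` cball 0 1 \<subseteq> (\<Union>x\<in>k. ball x (e/2))"
      using s \<open>e > 0\<close> unfolding compact_operators_iff compact_closure_iff_totally_bounded
      by (meson half_gt_zero)
    have "t x \<in> (\<Union>x\<in>k. ball x e)" if "x \<in> cball 0 1" for x
    proof -
      have "s x \<in> (\<Union>y\<in>k. ball y (e/2))"
        using k(2) that by blast
      then obtain y where y: "y \<in> k" "dist y (s x) < e/2"
        by auto
      have "dist (s x) (t x) = norm ((s - t) x)"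
        by (simp add: dist_norm blinfun.diff_left)
      also have "\<dots> \<le> norm (s - t) * norm x"
        by (rule norm_blinfun)
      also have "\<dots> \<le> norm (s - t) * 1"
        using that by (intro mult_left_mono) auto
      finally have "dist (s x) (t x) < e/2"
        using s by (simp add: dist_norm)
      with y have "dist y (t x) < e"
        using dist_triangle[of y "t x" "s x"] by linarith
      with y show ?thesis by auto
    qed
    with k show ?thesis by blast
  qed
  ultimately show "t \<in> compact_operators"
    by (simp add: compact_operators_iff compact_closure_iff_totally_bounded)
qed


section \<open>Diagonal operators\<close>

text \<open>Matches the operator norm with the supremum used in \<open>operator_norm_on\<close>, and
  lets norm estimates be tested on the unit ball, where finite nets are available.\<close>

lemma norm_blinfun_eq_SUP_cball:
  fixes f :: "'a::real_normed_vector \<Rightarrow>\<^sub>L 'b::real_normed_vector"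
  shows "norm f = (SUP x\<in>cball 0 1. norm (f x))"
proof (rule antisym)
  have le: "norm (f x) \<le> norm f" if "x \<in> cball 0 1" for x
    using that norm_blinfun[of f x] by (simp add: mult_left_le order_trans)
  then have bdd: "bdd_above ((\<lambda>x. norm (f x)) ` cball 0 1)"
    by (rule bdd_aboveI2)
  show "(SUP x\<in>cball 0 1. norm (f x)) \<le> norm f"
    by (rule cSUP_least) (use le in auto)
  show "norm f \<le> (SUP x\<in>cball 0 1. norm (f x))"
  proof (rule norm_blinfun_bound)
    show "0 \<le> (SUP x\<in>cball 0 1. norm (f x))"
      by (rule cSUP_upper2[OF bdd, of 0]) auto
    show "norm (f x) \<le> (SUP x\<in>cball 0 1. norm (f x)) * norm x" for x
    proof (cases "x = 0")
      case False
      have "norm (f (x /\<^sub>R norm x)) \<le> (SUP x\<in>cball 0 1. norm (f x))"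
        by (rule cSUP_upper[OF _ bdd]) (use False in auto)
      then show ?thesis
        using False by (simp add: blinfun.scaleR_right field_simps)
    qed simp
  qed
qed

text \<open>Trades an operator on the range of \<open>q\<close> for one on the whole space. On that
  range \<open>s\<close> agrees with \<open>q o\<^sub>L t\<close>, and \<open>q\<close> maps the
  unit ball onto the unit ball of its range, so both operators have the same image of the unit ball;
  compactness and norm depend on that image only.\<close>

lemma corner_of_projection:
  assumes q: "is_projection q" and t: "t \<in> bounded_operators"
    and s: "\<And>x. q (t x) = s (q x)"
  shows "s \<in> compact_operators_on (range q) \<longleftrightarrow> q o\<^sub>L t \<in> compact_operators"
    and "operator_norm_on (range q) s = norm (q o\<^sub>L t)"
proof -
  have s': "s v = (q o\<^sub>L t) v" if "v \<in> range q" for v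
    using that s[of v] by (simp add: is_projection_range[OF q])
  have image: "s ` (range q \<inter> cball 0 1) = (q o\<^sub>L t) ` cball 0 1"
  proof
    show "s ` (range q \<inter> cball 0 1) \<subseteq> (q o\<^sub>L t) ` cball 0 1"
      using s' by auto
    show "(q o\<^sub>L t) ` cball 0 1 \<subseteq> s ` (range q \<inter> cball 0 1)"
    proof
      fix y assume "y \<in> (q o\<^sub>L t) ` cball 0 1"
      then obtain x where "norm x \<le> 1" "y = s (q x)"
        by (auto simp: s)
      then show "y \<in> s ` (range q \<inter> cball 0 1)"
        using is_projection_norm_le(1)[OF q, of x] by auto
    qed
  qed
  have add: "x + y \<in> range q" if "x \<in> range q" "y \<in> range q" for x y
    using that by (simp add: is_projection_range[OF q] blinfun.add_right)
  have q': "q \<in> bounded_operators"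
    using q by (simp add: is_projection_def)
  have scale: "c *\<^sub>C x \<in> range q" if "x \<in> range q" for c x
    using that q' by (simp add: is_projection_range[OF q] bounded_operators_iff)
  have qt: "q o\<^sub>L t \<in> bounded_operators"
    using q' t by (rule bounded_operators_compose)
  have "s ` range q \<subseteq> range q"
    using s' by auto
  moreover have "\<forall>x\<in>range q. \<forall>y\<in>range q. s (x + y) = s x + s y"
    using s' add blinfun.add_right by metis
  moreover have "\<forall>c. \<forall>x\<in>range q. s (c *\<^sub>C x) = c *\<^sub>C s x"
    using s' scale qt unfolding bounded_operators_iff by metis
  ultimately show "s \<in> compact_operators_on (range q) \<longleftrightarrow> q o\<^sub>L t \<in> compact_operators"
    using qt unfolding compact_operators_on_def compact_operators_iff image mem_Collect_eq
    by argo
  have "operator_norm_on (range q) s = Sup (norm ` s ` (range q \<inter> cball 0 1))"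
    by (simp add: operator_norm_on_def image_image)
  also have "\<dots> = norm (q o\<^sub>L t)"
    unfolding image norm_blinfun_eq_SUP_cball by (simp add: image_image)
  finally show "operator_norm_on (range q) s = norm (q o\<^sub>L t)" .
qed

text \<open>Eliminates the family \<open>s\<close>: on the range of \<open>q i\<close> its member
  can only be \<open>q i o\<^sub>L t\<close>. The equation that replaces it says that the
  \<open>i\<close>-th component of \<open>t x\<close> depends on the \<open>i\<close>-th component
  of \<open>x\<close> alone.\<close>

lemma diagonal_c0_sum_compacts_iff:
  assumes q: "\<And>i. i \<in> I \<Longrightarrow> is_projection (q i)"
  shows "t \<in> diagonal_c0_sum_compacts I q \<longleftrightarrow>
    t \<in> bounded_operators
    \<and> (\<forall>i\<in>I. q i o\<^sub>L t o\<^sub>L q i = q i o\<^sub>L t \<and> q i o\<^sub>L t \<in> compact_operators)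
    \<and> (\<forall>\<epsilon>>0. finite {i \<in> I. \<epsilon> \<le> norm (q i o\<^sub>L t)})"
    (is "?L \<longleftrightarrow> ?R")
proof
  assume ?L
  then obtain s where t: "t \<in> bounded_operators"
    and s: "s \<in> c0_sum_compacts I (\<lambda>i. range (q i))"
    and st: "\<And>x i. i \<in> I \<Longrightarrow> q i (t x) = s i (q i x)"
    unfolding diagonal_c0_sum_compacts_def by blast
  note corner = corner_of_projection[OF q t st]
  have "{i \<in> I. \<epsilon> \<le> norm (q i o\<^sub>L t)} = {i \<in> I. \<epsilon> \<le> operator_norm_on (range (q i)) (s i)}" for \<epsilon>
    using corner(2) by auto
  then have "\<forall>\<epsilon>>0. finite {i \<in> I. \<epsilon> \<le> norm (q i o\<^sub>L t)}"
    using s by (simp add: c0_sum_compacts_def)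
  moreover have "q i o\<^sub>L t \<in> compact_operators" if "i \<in> I" for i
    using s corner(1)[OF that that] that by (simp add: c0_sum_compacts_def)
  moreover have "q i o\<^sub>L t o\<^sub>L q i = q i o\<^sub>L t" if "i \<in> I" for i
    by (rule blinfun_eqI) (simp add: st that is_projection_idem q)
  ultimately show ?R
    using t by blast
next
  assume R: ?R
  then have t: "t \<in> bounded_operators" by blast
  have st: "q i (t x) = (q i o\<^sub>L t) (q i x)" if "i \<in> I" for i x
    using R that by (metis blinfun_apply_blinfun_compose)
  note corner = corner_of_projection[OF q t st]
  have "{i \<in> I. \<epsilon> \<le> operator_norm_on (range (q i)) (q i o\<^sub>L t)} = {i \<in> I. \<epsilon> \<le> norm (q i o\<^sub>L t)}" for \<epsilon>
    using corner(2) by (auto simp del: blinfun_apply_blinfun_compose)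
  then have s: "(\<lambda>i. blinfun_apply (q i o\<^sub>L t)) \<in> c0_sum_compacts I (\<lambda>i. range (q i))"
    using R corner(1) by (simp add: c0_sum_compacts_def del: blinfun_apply_blinfun_compose)
  show ?L
    unfolding diagonal_c0_sum_compacts_def mem_Collect_eq
    by (rule conjI[OF t bexI[OF _ s]]) (intro allI ballI st)
qed


section \<open>Modules over coarse spaces\<close>

context coarse_module
begin

lemma p_bounded: "A \<in> \<AA> \<Longrightarrow> p A \<in> bounded_operators"
  using projection by (simp add: is_projection_def)

lemma p_p: "A \<in> \<AA> \<Longrightarrow> B \<in> \<AA> \<Longrightarrow> p A (p B x) = p (A \<inter> B) x"
  by (simp add: proj_Int)

lemma p_Un_disjoint:
  "A \<in> \<AA> \<Longrightarrow> B \<in> \<AA> \<Longrightarrow> A \<inter> B = {} \<Longrightarrow> p (A \<union> B) = p A + p B"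
  using proj_Int[of A B] by (simp add: proj_Un proj_empty)

lemma p_compl:
  assumes "A \<in> \<AA>"
  shows "p (X - A) x = x - p A x"
proof -
  have "A \<union> (X - A) = X"
    using assms sets_into_space by blast
  then have "p X = p A + p (X - A)"
    using p_Un_disjoint[of A "X - A"] assms by auto
  then have "p X x = p A x + p (X - A) x"
    by (simp add: blinfun.add_left)
  then show ?thesis
    by (simp add: proj_space algebra_simps)
qed

text \<open>The vector \<open>p A x\<close> is fixed by \<open>p B\<close>, so the residual for
  \<open>B\<close> is the residual for \<open>A\<close> with its \<open>p B\<close> part removed,
  which is a contraction.\<close>

lemma p_residual_mono:
  assumes "A \<in> \<AA>" "B \<in> \<AA>" "A \<subseteq> B"
  shows "norm (x - p B x) \<le> norm (x - p A x)"
proof -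
  have "p B (p A x) = p A x"
    using assms by (simp add: p_p inf.absorb2)
  then have "x - p B x = (x - p A x) - p B (x - p A x)"
    by (simp add: blinfun.diff_right)
  then show ?thesis
    using is_projection_norm_le(2)[OF projection[OF assms(2)]] by metis
qed

text \<open>The residual of \<open>v\<close> for \<open>B\<close> is killed by \<open>p A\<close>,
  hence is its own residual for \<open>A\<close>; the assumed bound is applied to it instead of to
  \<open>v\<close>.\<close>

lemma functional_residual_mono:
  assumes "A \<in> \<AA>" "B \<in> \<AA>" "A \<subseteq> B"
    and bound: "\<And>v. \<bar>f (v - p A v)\<bar> \<le> \<epsilon> * norm v" and "0 \<le> \<epsilon>"
  shows "\<bar>f (v - p B v)\<bar> \<le> \<epsilon> * norm v"
proof -
  let ?w = "v - p B v"
  have "p A ?w = 0"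
    using assms by (simp add: p_p inf.absorb1 blinfun.diff_right)
  then have "\<bar>f ?w\<bar> \<le> \<epsilon> * norm ?w"
    using bound[of ?w] by simp
  also have "\<dots> \<le> \<epsilon> * norm v"
    using is_projection_norm_le(2)[OF projection[OF assms(2)]] \<open>0 \<le> \<epsilon>\<close>
    by (rule mult_left_mono)
  finally show ?thesis .
qed

section \<open>Sums, corners and inclusions of the operator algebras\<close>

lemma controlled_propagation_add:
  assumes "controlled_propagation \<E> \<AA> p s" "controlled_propagation \<E> \<AA> p t"
  shows "controlled_propagation \<E> \<AA> p (s + t)"
proof -
  obtain E F where E: "E \<in> \<E>" "\<forall>B\<in>\<AA>. \<forall>A\<in>\<AA>. separated E B A \<longrightarrow> p B o\<^sub>L s o\<^sub>L p A = 0"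
    and F: "F \<in> \<E>" "\<forall>B\<in>\<AA>. \<forall>A\<in>\<AA>. separated F B A \<longrightarrow> p B o\<^sub>L t o\<^sub>L p A = 0"
    using assms unfolding controlled_propagation_def by blast
  have "p B o\<^sub>L (s + t) o\<^sub>L p A = 0" if "B \<in> \<AA>" "A \<in> \<AA>" "separated (E \<union> F) B A" for A B
  proof -
    have "separated E B A" "separated F B A"
      using that(3) by (auto simp: separated_def nbhd_def)
    then have "p B o\<^sub>L s o\<^sub>L p A = 0" "p B o\<^sub>L t o\<^sub>L p A = 0"
      using E F that by blast+
    moreover have "p B o\<^sub>L (s + t) o\<^sub>L p A = (p B o\<^sub>L s o\<^sub>L p A) + (p B o\<^sub>L t o\<^sub>L p A)"
      by (rule blinfun_eqI) (simp add: blinfun.add_left blinfun.add_right)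
    ultimately show ?thesis by simp
  qed
  then show ?thesis
    using union_closed[OF E(1) F(1)] unfolding controlled_propagation_def by blast
qed

lemma locally_compact_operator_add:
  assumes "locally_compact_operator \<E> \<AA> p s" "locally_compact_operator \<E> \<AA> p t"
  shows "locally_compact_operator \<E> \<AA> p (s + t)"
  unfolding locally_compact_operator_def
proof (intro ballI impI)
  fix A assume "A \<in> \<AA>" "coarse_bounded \<E> A"
  then have "(p A o\<^sub>L s) + (p A o\<^sub>L t) \<in> compact_operators"
    "(s o\<^sub>L p A) + (t o\<^sub>L p A) \<in> compact_operators"
    using assms unfolding locally_compact_operator_def by (blast intro: compact_operators_add)+
  moreover have "p A o\<^sub>L (s + t) = (p A o\<^sub>L s) + (p A o\<^sub>L t)"
    "(s + t) o\<^sub>L p A = (s o\<^sub>L p A) + (t o\<^sub>L p A)"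
    by (rule blinfun_eqI, simp add: blinfun.add_left blinfun.add_right)+
  ultimately show "p A o\<^sub>L (s + t) \<in> compact_operators \<and> (s + t) o\<^sub>L p A \<in> compact_operators"
    by simp
qed

lemma C_Roe_add:
  assumes "s \<in> C_Roe \<E> \<AA> p" "t \<in> C_Roe \<E> \<AA> p"
  shows "s + t \<in> C_Roe \<E> \<AA> p"
proof -
  let ?D = "{t \<in> bounded_operators.
       controlled_propagation \<E> \<AA> p t \<and> locally_compact_operator \<E> \<AA> p t}"
  obtain f g where fg: "\<And>n. f n \<in> ?D" "f \<longlonglongrightarrow> s" "\<And>n. g n \<in> ?D" "g \<longlonglongrightarrow> t"
    using assms unfolding C_Roe_def closure_sequential by blast
  have "f n + g n \<in> ?D" for n
    using fg(1,3)[of n]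
    by (simp add: bounded_operators_add controlled_propagation_add locally_compact_operator_add)
  moreover have "(\<lambda>n. f n + g n) \<longlonglongrightarrow> s + t"
    by (intro tendsto_add fg)
  ultimately show ?thesis
    unfolding C_Roe_def closure_sequential by (intro exI[of _ "\<lambda>n. f n + g n"]) simp
qed

text \<open>The square \<open>V \<times> V\<close> is itself an entourage, and two sets separated
  for it cannot both meet \<open>V\<close>, so it controls the propagation. Local compactness is
  automatic for a compact operator.\<close>

lemma C_Roe_corner:
  assumes K: "K \<in> compact_operators" and V: "V \<in> \<AA>" "coarse_bounded \<E> V"
  shows "p V o\<^sub>L K o\<^sub>L p V \<in> C_Roe \<E> \<AA> p"
proof -
  let ?K = "p V o\<^sub>L K o\<^sub>L p V"
  have K': "?K \<in> compact_operators"
    by (intro compact_operators_compose_left compact_operators_compose_right p_bounded V K)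
  have "p B o\<^sub>L ?K o\<^sub>L p A = 0" if "B \<in> \<AA>" "A \<in> \<AA>" "separated (V \<times> V) B A" for A B
  proof -
    have "B \<inter> V = {} \<or> V \<inter> A = {}"
      using that by (auto simp: separated_def nbhd_def)
    then have "p B (p V x) = 0 \<or> p V (p A y) = 0" for x y
      using that V by (auto simp: p_p proj_empty)
    then have "(p B o\<^sub>L ?K o\<^sub>L p A) x = 0" for x
      by (metis blinfun_apply_blinfun_compose blinfun.zero_right)
    then show ?thesis
      by (intro blinfun_eqI) simp
  qed
  then have "controlled_propagation \<E> \<AA> p ?K"
    using V by (auto simp: controlled_propagation_def coarse_bounded_def)
  moreover have "locally_compact_operator \<E> \<AA> p ?K"
    unfolding locally_compact_operator_def
    by (intro ballI impI conjI compact_operators_compose_left compact_operators_compose_right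
        K' p_bounded)
  ultimately show ?thesis
    using compact_operators_bounded[OF K'] unfolding C_Roe_def
    by (intro subsetD[OF closure_subset] CollectI conjI)
qed

lemma C_Roe_subset_C_cp: "C_Roe \<E> \<AA> p \<subseteq> C_cp \<E> \<AA> p"
  unfolding C_Roe_def C_cp_def by (rule closure_mono) blast

text \<open>An approximant of controlled propagation supplies the entourage: between separated sets
  only the difference \<open>s - t\<close> survives, and compressing by projections does not enlarge
  its norm.\<close>

lemma C_cp_subset_C_ql: "C_cp \<E> \<AA> p \<subseteq> C_ql \<E> \<AA> p"
proof
  fix t assume t: "t \<in> C_cp \<E> \<AA> p"
  have "C_cp \<E> \<AA> p \<subseteq> bounded_operators"
    unfolding C_cp_def by (rule closure_minimal[OF Collect_subset closed_bounded_operators])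
  with t have "t \<in> bounded_operators" by (rule rev_subsetD)
  moreover have "\<exists>E\<in>\<E>. \<forall>B\<in>\<AA>. \<forall>A\<in>\<AA>. separated E B A \<longrightarrow> norm (p B o\<^sub>L t o\<^sub>L p A) \<le> \<epsilon>"
    if "\<epsilon> > 0" for \<epsilon>
  proof -
    obtain s where s: "controlled_propagation \<E> \<AA> p s" "norm (s - t) < \<epsilon>"
      using t \<open>\<epsilon> > 0\<close> unfolding C_cp_def closure_approachable dist_norm by blast
    then obtain E where E: "E \<in> \<E>" "\<forall>B\<in>\<AA>. \<forall>A\<in>\<AA>. separated E B A \<longrightarrow> p B o\<^sub>L s o\<^sub>L p A = 0"
      unfolding controlled_propagation_def by blast
    have "norm (p B o\<^sub>L t o\<^sub>L p A) \<le> \<epsilon>" if "B \<in> \<AA>" "A \<in> \<AA>" "separated E B A" for A B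
    proof -
      have "p B o\<^sub>L t o\<^sub>L p A = (p B o\<^sub>L s o\<^sub>L p A) - (p B o\<^sub>L (s - t) o\<^sub>L p A)"
        by (rule blinfun_eqI) (simp add: blinfun.diff_left blinfun.diff_right)
      then have "norm (p B o\<^sub>L t o\<^sub>L p A) = norm (p B o\<^sub>L (s - t) o\<^sub>L p A)"
        using E that by simp
      also have "\<dots> \<le> norm (p B) * norm (s - t) * norm (p A)"
        by (meson norm_blinfun_compose mult_right_mono norm_ge_zero order_trans)
      also have "\<dots> \<le> 1 * norm (s - t) * 1"
        by (intro mult_mono norm_projection_le projection that) auto
      finally show ?thesis using s by simp
    qed
    with E show ?thesis by blast
  qed
  ultimately show "t \<in> C_ql \<E> \<AA> p"
    by (simp add: C_ql_def quasi_local_def)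
qed

end


section \<open>Modules with measurable components\<close>

locale coarse_module_components = coarse_module X \<E> \<AA> p
  for X :: "'x set" and \<E> :: "('x \<times> 'x) set set" and \<AA> :: "'x set set"
    and p :: "'x set \<Rightarrow> 'h::complex_hilbert_space \<Rightarrow>\<^sub>L 'h" +
  fixes I :: "'i set" and Xc :: "'i \<Rightarrow> 'x set"
  assumes components: "coarse_components X \<E> I Xc"
    and measurable_component: "i \<in> I \<Longrightarrow> Xc i \<in> \<AA>"
begin

section \<open>Bounded sets and the component decomposition\<close>

lemma components_cover: "x \<in> X \<Longrightarrow> \<exists>i\<in>I. x \<in> Xc i"
  using components unfolding coarse_components_def by blast

lemma components_disjoint: "i \<in> I \<Longrightarrow> j \<in> I \<Longrightarrow> i \<noteq> j \<Longrightarrow> Xc i \<inter> Xc j = {}"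
  using components unfolding coarse_components_def disjoint_family_on_def by blast

lemma bounded_meets_one_component:
  assumes "coarse_bounded \<E> C" "i \<in> I" "j \<in> I" "C \<inter> Xc i \<noteq> {}" "C \<inter> Xc j \<noteq> {}"
  shows "i = j"
  using assms components unfolding coarse_components_def coarsely_disjoint_def by blast

lemma coarse_bounded_subset: "coarse_bounded \<E> C \<Longrightarrow> D \<subseteq> C \<Longrightarrow> coarse_bounded \<E> D"
  unfolding coarse_bounded_def by (erule subset_closed) blast

text \<open>A pair \<open>(x, a)\<close> in \<open>E\<close> makes \<open>{x, a}\<close> bounded,
  its square being covered by \<open>E\<close>, its transpose and the diagonal. A bounded set cannot
  meet two components, so no entourage leads out of one.\<close>

lemma component_separated:
  assumes "i \<in> I" "E \<in> \<E>"
  shows "separated E (Xc i) (X - Xc i)"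
proof -
  have False if xa: "x \<in> Xc i" "a \<in> X - Xc i" "(x, a) \<in> E" for x a
  proof -
    obtain j where j: "j \<in> I" "a \<in> Xc j"
      using components_cover xa by blast
    have "{x, a} \<subseteq> X"
      using entourage_subset[OF assms(2)] xa by blast
    then have "{x, a} \<times> {x, a} \<subseteq> E \<union> E\<inverse> \<union> Id_on X"
      using that by auto
    then have "coarse_bounded \<E> {x, a}"
      unfolding coarse_bounded_def
      using subset_closed union_closed diagonal transpose_closed assms(2) by meson
    then have "i = j"
      using bounded_meets_one_component[of "{x, a}" i j] assms j that by auto
    with j that show False by blast
  qed
  then show ?thesis
    by (auto simp: separated_def nbhd_def)
qed

text \<open>Connectedness of the component bounds \<open>{a, b}\<close> for one point from each set;
  composing with the two squares passes from \<open>A\<close> through \<open>a\<close> and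
  \<open>b\<close> to \<open>B\<close>, which yields the mixed block
  \<open>A \<times> B\<close>.\<close>

lemma coarse_bounded_Un:
  assumes i: "i \<in> I" and A: "coarse_bounded \<E> A" "A \<subseteq> Xc i" and B: "coarse_bounded \<E> B" "B \<subseteq> Xc i"
  shows "coarse_bounded \<E> (A \<union> B)"
proof (cases "A = {} \<or> B = {}")
  case False
  then obtain a b where ab: "a \<in> A" "b \<in> B" by blast
  have "coarsely_connected (Xc i) (restrict_coarse \<E> (Xc i))"
    using components i unfolding coarse_components_def by blast
  moreover have "{a, b} \<subseteq> Xc i" "finite {a, b}"
    using ab A B by auto
  ultimately have "{a, b} \<times> {a, b} \<in> \<E>"
    unfolding coarsely_connected_def coarse_bounded_def restrict_coarse_def by blast
  then have "(A \<times> A) O ({a, b} \<times> {a, b}) O (B \<times> B) \<in> \<E>"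
    using A B by (intro comp_closed) (auto simp: coarse_bounded_def)
  then have AB: "A \<times> B \<in> \<E>"
    by (rule subset_closed) (use ab in auto)
  then have "B \<times> A \<in> \<E>"
    using transpose_closed[OF AB] by (simp add: converse_Times)
  then have "(A \<times> A) \<union> (B \<times> B) \<union> ((A \<times> B) \<union> (B \<times> A)) \<in> \<E>"
    using A B AB by (intro union_closed) (auto simp: coarse_bounded_def)
  then show ?thesis
    unfolding coarse_bounded_def by (rule subset_closed) blast
qed (use A B in auto)

text \<open>
  A finite union of bounded sets need not be bounded, as it may meet several components;
  \<open>small\<close> is closed under finite unions.
\<close>

definition small :: "'x set \<Rightarrow> bool" where
  "small U \<longleftrightarrow> U \<in> \<AA> \<and> finite {i \<in> I. U \<inter> Xc i \<noteq> {}}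
    \<and> (\<forall>i\<in>I. coarse_bounded \<E> (U \<inter> Xc i))"

lemma small_measurable: "small U \<Longrightarrow> U \<in> \<AA>"
  by (simp add: small_def)

lemma small_bounded:
  assumes "A \<in> \<AA>" "coarse_bounded \<E> A"
  shows "small A"
proof -
  have "\<exists>i. {i \<in> I. A \<inter> Xc i \<noteq> {}} \<subseteq> {i}"
    using bounded_meets_one_component[OF assms(2)] by blast
  then have "finite {i \<in> I. A \<inter> Xc i \<noteq> {}}"
    by (meson finite.emptyI finite.insertI finite_subset)
  then show ?thesis
    using assms coarse_bounded_subset by (auto simp: small_def)
qed

lemma small_empty: "small {}"
proof -
  have "{} \<in> \<E>"
    using diagonal subset_closed by blast
  then show ?thesis
    by (intro small_bounded) (simp_all add: coarse_bounded_def)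
qed

lemma small_Un:
  assumes "small U" "small V"
  shows "small (U \<union> V)"
proof -
  have "{i \<in> I. (U \<union> V) \<inter> Xc i \<noteq> {}} = {i \<in> I. U \<inter> Xc i \<noteq> {}} \<union> {i \<in> I. V \<inter> Xc i \<noteq> {}}"
    by blast
  moreover have "coarse_bounded \<E> ((U \<union> V) \<inter> Xc i)" if "i \<in> I" for i
    using coarse_bounded_Un[of i "U \<inter> Xc i" "V \<inter> Xc i"] that assms
    by (simp add: small_def Int_Un_distrib2)
  ultimately show ?thesis
    using assms by (simp add: small_def Un)
qed

text \<open>Small sets are directed, so requirements that survive enlargement can be met together
  for finitely many objects. The index set will be a finite net.\<close>

lemma small_simultaneous:
  assumes "finite S" and "\<And>x. x \<in> S \<Longrightarrow> \<exists>U. small U \<and> Q x U"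
    and mono: "\<And>x U V. Q x U \<Longrightarrow> small U \<Longrightarrow> small V \<Longrightarrow> U \<subseteq> V \<Longrightarrow> Q x V"
  shows "\<exists>U. small U \<and> (\<forall>x\<in>S. Q x U)"
  using assms(1,2)
proof (induction S)
  case empty
  then show ?case using small_empty by blast
next
  case (insert x S)
  then obtain U V where "small U" "\<forall>x\<in>S. Q x U" "small V" "Q x V"
    by blast
  then have "small (U \<union> V) \<and> (\<forall>y\<in>insert x S. Q y (U \<union> V))"
    using mono small_Un by (metis Un_upper1 Un_upper2 insert_iff)
  then show ?case by blast
qed

section \<open>Approximation by the projections of small sets\<close>

text \<open>The vectors fixed by the projection of some small set form a complex subspace, by
  directedness. It contains the generators from non-degeneracy, hence is dense.\<close>

lemma small_approx:
  assumes "\<epsilon> > 0"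
  shows "\<exists>U. small U \<and> norm (x - p U x) \<le> \<epsilon>"
proof -
  obtain E where E: "gauge_of X \<E> E"
    "closure (cspan (\<Union>A\<in>{A \<in> \<AA>. A \<times> A \<subseteq> E}. range (p A))) = UNIV"
    using nondegenerate by blast
  let ?S = "{x. \<exists>U. small U \<and> p U x = x}"
  have fixed: "p V x = x" if "small U" "small V" "U \<subseteq> V" "p U x = x" for U V x
  proof -
    have "p V (p U x) = p U x"
      using that(1-3) by (simp add: p_p small_measurable inf.absorb2)
    with that(4) show ?thesis by simp
  qed
  have subspace: "complex_vector.subspace ?S"
  proof (rule complex_vector.subspaceI)
    show "0 \<in> ?S" using small_empty by auto
  next
    fix x y assume "x \<in> ?S" "y \<in> ?S"
    then obtain U V where UV: "small U" "p U x = x" "small V" "p V y = y" by blast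
    then have "p (U \<union> V) (x + y) = x + y"
      using fixed[of U "U \<union> V" x] fixed[of V "U \<union> V" y] small_Un
      by (simp add: blinfun.add_right)
    then show "x + y \<in> ?S"
      using small_Un UV by blast
  next
    fix c x assume "x \<in> ?S"
    then obtain U where U: "small U" "p U x = x" by blast
    then have "p U (c *\<^sub>C x) = c *\<^sub>C x"
      using p_bounded[OF small_measurable[OF U(1)]] by (simp add: bounded_operators_iff)
    then show "c *\<^sub>C x \<in> ?S"
      using U by blast
  qed
  have "(\<Union>A\<in>{A \<in> \<AA>. A \<times> A \<subseteq> E}. range (p A)) \<subseteq> ?S"
  proof clarify
    fix A x assume A: "A \<in> \<AA>" "A \<times> A \<subseteq> E"
    then have "small A"
      using E(1) subset_closed
      by (intro small_bounded) (auto simp: coarse_bounded_def gauge_of_def)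
    then show "\<exists>U. small U \<and> p U (p A x) = p A x"
      using is_projection_idem[OF projection[OF A(1)]] by blast
  qed
  then have "cspan (\<Union>A\<in>{A \<in> \<AA>. A \<times> A \<subseteq> E}. range (p A)) \<subseteq> ?S"
    by (rule complex_vector.span_minimal[OF _ subspace])
  from subsetD[OF closure_mono[OF this]] have "x \<in> closure ?S"
    unfolding E(2) by blast
  then obtain y U where y: "norm (y - x) < \<epsilon>" and U: "small U" "p U y = y"
    using \<open>\<epsilon> > 0\<close> unfolding closure_approachable dist_norm by blast
  \<comment> \<open>Since \<open>y\<close> is fixed by \<open>p U\<close>, the residual of
    \<open>x\<close> is that of \<open>x - y\<close>, so no error beyond the approximation of
    \<open>x\<close> by \<open>y\<close> arises.\<close>
  have "x - p U x = (x - y) - p U (x - y)"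
    using U by (simp add: blinfun.diff_right)
  then have "norm (x - p U x) \<le> norm (x - y)"
    using is_projection_norm_le(2)[OF projection[OF small_measurable[OF U(1)]]] by metis
  with y U show ?thesis
    by (metis less_imp_le norm_minus_commute order_trans)
qed

text \<open>The bound is uniform in \<open>v\<close>. If the range of \<open>p U\<close> contains a
  vector at which \<open>f\<close> nearly attains its norm, \<open>functional_pythagoras\<close>
  leaves almost nothing of \<open>f\<close> on the kernel of \<open>p U\<close>.\<close>

lemma small_approx_functional:
  fixes f :: "'h \<Rightarrow> real"
  assumes f: "bounded_linear f" and "\<epsilon> > 0"
  shows "\<exists>U. small U \<and> (\<forall>v. \<bar>f (v - p U v)\<bar> \<le> \<epsilon> * norm v)"
proof (cases "onorm f = 0")
  case True
  then have "f v = 0" for v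
    using onorm[OF f, of v] by simp
  then show ?thesis
    using small_empty \<open>\<epsilon> > 0\<close> by (intro exI[of _ "{}"]) simp
next
  case False
  interpret f: bounded_linear f by (rule f)
  define N where "N = onorm f"
  have "N > 0"
    using False onorm_pos_le[OF f] by (simp add: N_def)
  \<comment> \<open>On the kernel, the square of \<open>f\<close> will be at most
    \<open>N\<^sup>2 - (N - e)\<^sup>2\<close>, hence at most \<open>2 * N * e\<close>, which must
    not exceed \<open>\<epsilon>\<^sup>2\<close>. The cap at \<open>N\<close> keeps
    \<open>N - e\<close> nonnegative, so inequalities with it can be squared.\<close>
  define e where "e = min N (\<epsilon>\<^sup>2 / (2 * N))"
  have e: "e > 0" "e \<le> N" "2 * N * e \<le> \<epsilon>\<^sup>2"
    using \<open>N > 0\<close> \<open>\<epsilon> > 0\<close> by (auto simp: e_def min_def field_simps)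
  \<comment> \<open>Otherwise \<open>N - e/2\<close>, tested on unit vectors of both signs, would
    bound the absolute value of \<open>f\<close> and contradict the choice of \<open>N\<close> as
    its norm.\<close>
  have "\<exists>x. norm x \<le> 1 \<and> f x > N - e/2"
  proof (rule ccontr)
    assume "\<nexists>x. norm x \<le> 1 \<and> f x > N - e/2"
    then have le: "f x \<le> N - e/2" if "norm x \<le> 1" for x
      using that by force
    have "norm (f x) \<le> (N - e/2) * norm x" for x
    proof (cases "x = 0")
      case False
      then have "f (x /\<^sub>R norm x) \<le> N - e/2" "f ((- x) /\<^sub>R norm x) \<le> N - e/2"
        by (intro le; simp)+
      moreover have "f (x /\<^sub>R norm x) = f x / norm x" "f ((- x) /\<^sub>R norm x) = - (f x / norm x)"
        by (simp_all only: f.scaleR f.neg) (simp_all add: divide_inverse)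
      ultimately have "f x / norm x \<le> N - e/2" "- (f x / norm x) \<le> N - e/2"
        by simp_all
      then show ?thesis
        using False by (simp add: field_simps abs_le_iff)
    qed (simp add: f.zero)
    moreover have "0 \<le> N - e/2"
      using e by simp
    ultimately have "onorm f \<le> N - e/2"
      by (intro onorm_bound)
    then show False
      using e by (simp add: N_def)
  qed
  then obtain x where x: "norm x \<le> 1" "f x > N - e/2" by blast
  \<comment> \<open>Moving \<open>x\<close> into the range of \<open>p U\<close> with this tolerance
    costs at most \<open>e/2\<close> in the value of \<open>f\<close>; with the deficit
    \<open>e/2\<close> at \<open>x\<close> the total loss is \<open>e\<close>.\<close>
  obtain U where U: "small U" "norm (x - p U x) \<le> e / (2 * N)"
    using small_approx[of "e / (2 * N)" x] e \<open>N > 0\<close> by auto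
  note pU = projection[OF small_measurable[OF U(1)]]
  define u where "u = p U x"
  have u: "p U u = u" "norm u \<le> 1"
    using is_projection_norm_le(1)[OF pU, of x] x(1)
    by (simp_all add: u_def is_projection_idem[OF pU])
  have "f (x - u) \<le> N * norm (x - u)"
    using onorm[OF f, of "x - u"] by (simp add: N_def)
  also have "\<dots> \<le> N * (e / (2 * N))"
    using U \<open>N > 0\<close> by (intro mult_left_mono) (simp_all add: u_def)
  also have "\<dots> = e / 2"
    using \<open>N > 0\<close> by simp
  finally have "f u \<ge> N - e"
    using x by (simp add: f.diff)
  then have fu: "(N - e)\<^sup>2 \<le> (f u)\<^sup>2"
    using e by (intro power_mono) auto
  have "\<bar>f (v - p U v)\<bar> \<le> \<epsilon> * norm v" for v
  proof (cases "v - p U v = 0")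
    case False
    define w where "w = v - p U v"
    define z where "z = w /\<^sub>R norm w"
    have "w \<noteq> 0" using False by (simp add: w_def)
    have "p U w = 0"
      by (simp add: w_def blinfun.diff_right is_projection_idem[OF pU])
    then have "p U z = 0" "norm z \<le> 1"
      using \<open>w \<noteq> 0\<close> by (simp_all add: z_def blinfun.scaleR_right)
    then have "(f u)\<^sup>2 + (f z)\<^sup>2 \<le> N\<^sup>2"
      unfolding N_def by (intro functional_pythagoras[OF f pU u])
    then have "(f z)\<^sup>2 \<le> 2 * N * e - e\<^sup>2"
      using fu by (simp add: power2_diff)
    also have "\<dots> \<le> \<epsilon>\<^sup>2"
      using e(3) zero_le_power2[of e] by linarith
    finally have "\<bar>f z\<bar> \<le> \<epsilon>"
      using \<open>\<epsilon> > 0\<close> by (simp add: abs_le_square_iff[symmetric])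
    moreover have "f w = norm w * f z"
      using \<open>w \<noteq> 0\<close> by (simp add: z_def f.scaleR)
    ultimately have "\<bar>f w\<bar> \<le> \<epsilon> * norm w"
      using mult_left_mono[of "\<bar>f z\<bar>" \<epsilon> "norm w"] by (simp add: abs_mult mult.commute[of \<epsilon>])
    also have "\<dots> \<le> \<epsilon> * norm v"
      using is_projection_norm_le(2)[OF pU, of v] \<open>\<epsilon> > 0\<close> by (simp add: w_def)
    finally show ?thesis by (simp add: w_def)
  qed (use \<open>\<epsilon> > 0\<close> in \<open>simp add: f.zero\<close>)
  with U show ?thesis by blast
qed

text \<open>Pointwise convergence on a finite net of the image of the unit ball is uniform on the
  whole image: the error at \<open>K v\<close> is at most its distance to a net point plus the
  residual of that point.\<close>

lemma small_approx_compact_left: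
  assumes K: "K \<in> compact_operators" and "\<epsilon> > 0"
  shows "\<exists>U. small U \<and> norm (K - (p U o\<^sub>L K)) \<le> \<epsilon>"
proof -
  obtain k where k: "finite k" "K ` cball 0 1 \<subseteq> (\<Union>y\<in>k. ball y (\<epsilon>/2))"
    using K \<open>\<epsilon> > 0\<close> unfolding compact_operators_iff compact_closure_iff_totally_bounded
    by (meson half_gt_zero)
  have "\<exists>U. small U \<and> (\<forall>y\<in>k. norm (y - p U y) \<le> \<epsilon>/2)"
    using small_approx \<open>\<epsilon> > 0\<close> p_residual_mono small_measurable
    by (intro small_simultaneous k(1)) (meson half_gt_zero order_trans)+
  then obtain U where U: "small U" "\<forall>y\<in>k. norm (y - p U y) \<le> \<epsilon>/2" by blast
  note pU = projection[OF small_measurable[OF U(1)]]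
  have "norm ((K - (p U o\<^sub>L K)) v) \<le> \<epsilon>" if "v \<in> cball 0 1" for v
  proof -
    have "K v \<in> (\<Union>y\<in>k. ball y (\<epsilon>/2))"
      using k(2) that by blast
    then obtain y where y: "y \<in> k" "norm (K v - y) < \<epsilon>/2"
      by (auto simp: dist_norm norm_minus_commute)
    have "(K - (p U o\<^sub>L K)) v = ((K v - y) - p U (K v - y)) + (y - p U y)"
      by (simp add: blinfun.diff_left blinfun.diff_right)
    also have "norm \<dots> \<le> norm (K v - y) + \<epsilon>/2"
      using is_projection_norm_le(2)[OF pU] U(2) y(1) by (intro norm_triangle_mono) auto
    finally show ?thesis
      using y by simp
  qed
  then have "norm (K - (p U o\<^sub>L K)) \<le> \<epsilon>"
    unfolding norm_blinfun_eq_SUP_cball by (intro cSUP_least) auto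
  with U show ?thesis by blast
qed

text \<open>
  Testing \<open>y = K (v - p U v)\<close> against a finite net of \<open>K (cball 0 1)\<close> reduces the claim to
  finitely many functionals, so that no adjoint of \<open>K\<close> is needed.
\<close>

lemma small_approx_compact_right:
  assumes K: "K \<in> compact_operators" and "\<epsilon> > 0"
  shows "\<exists>U. small U \<and> norm (K - (K o\<^sub>L p U)) \<le> \<epsilon>"
proof -
  obtain k where k: "finite k" "K ` cball 0 1 \<subseteq> (\<Union>y\<in>k. ball y (\<epsilon>/2))"
    using K \<open>\<epsilon> > 0\<close> unfolding compact_operators_iff compact_closure_iff_totally_bounded
    by (meson half_gt_zero)
  \<comment> \<open>With this value the final estimate is quadratic in \<open>norm y\<close>, with
    both terms on its right balanced at \<open>norm y = \<epsilon>\<close>.\<close>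
  define \<delta> where "\<delta> = \<epsilon>\<^sup>2 / 2"
  have "\<delta> > 0" using \<open>\<epsilon> > 0\<close> by (simp add: \<delta>_def)
  define f where "f y x = Re (cinner y (K x))" for y x
  have f: "bounded_linear (f y)" for y
    unfolding f_def
    by (rule bounded_linear_compose[OF bounded_linear_Re_cinner blinfun.bounded_linear_right])
  have "\<exists>U. small U \<and> (\<forall>y\<in>k. \<forall>v. \<bar>f y (v - p U v)\<bar> \<le> \<delta> * norm v)"
  proof (rule small_simultaneous[OF k(1)])
    show "\<exists>U. small U \<and> (\<forall>v. \<bar>f y (v - p U v)\<bar> \<le> \<delta> * norm v)" for y
      by (rule small_approx_functional[OF f \<open>\<delta> > 0\<close>])
  next
    fix y U V assume *: "\<forall>v. \<bar>f y (v - p U v)\<bar> \<le> \<delta> * norm v" "small U" "small V" "U \<subseteq> V"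
    show "\<forall>v. \<bar>f y (v - p V v)\<bar> \<le> \<delta> * norm v"
      using functional_residual_mono[of U V "f y" \<delta>] * \<open>\<delta> > 0\<close> small_measurable by simp
  qed
  then obtain U where U: "small U" "\<forall>y\<in>k. \<forall>v. \<bar>f y (v - p U v)\<bar> \<le> \<delta> * norm v" by blast
  note pU = projection[OF small_measurable[OF U(1)]]
  have "norm ((K - (K o\<^sub>L p U)) v) \<le> \<epsilon>" if v: "v \<in> cball 0 1" for v
  proof -
    define w where "w = v - p U v"
    define y where "y = K w"
    have "w \<in> cball 0 1"
      using is_projection_norm_le(2)[OF pU, of v] v by (simp add: w_def)
    then have "K w \<in> (\<Union>y\<in>k. ball y (\<epsilon>/2))"
      using k(2) by blast
    then obtain z where z: "z \<in> k" "norm (y - z) < \<epsilon>/2"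
      by (auto simp: dist_norm norm_minus_commute y_def)
    have "f z w \<le> \<delta> * norm v"
      using U(2) z(1) by (metis w_def abs_le_D1)
    also have "\<dots> \<le> \<delta>"
      using v \<open>\<delta> > 0\<close> by (simp add: mult_left_le)
    finally have fz: "Re (cinner z y) \<le> \<delta>"
      by (simp add: f_def y_def)
    \<comment> \<open>Only the first slot is split at the net point \<open>z\<close>: the first
      summand is small by Cauchy-Schwarz, the second is the functional \<open>f z\<close> at
      \<open>w\<close>.\<close>
    have "(norm y)\<^sup>2 = Re (cinner (y - z) y) + Re (cinner z y)"
      using cinner_add_left[of "y - z" z y] by (simp add: norm_power2_eq_cinner)
    also have "Re (cinner (y - z) y) \<le> norm (y - z) * norm y"
      by (rule Re_cinner_le)
    also have "\<dots> \<le> \<epsilon>/2 * norm y"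
      using z by (intro mult_right_mono) auto
    finally have le: "(norm y)\<^sup>2 \<le> \<epsilon>/2 * norm y + \<epsilon>\<^sup>2/2"
      using fz by (simp add: \<delta>_def)
    \<comment> \<open>If \<open>norm y\<close> exceeded \<open>\<epsilon>\<close>, each of the two
      terms on the right of \<open>le\<close> would be less than half of
      \<open>(norm y)\<^sup>2\<close>.\<close>
    have "norm y \<le> \<epsilon>"
    proof (rule ccontr)
      assume "\<not> norm y \<le> \<epsilon>"
      then have "\<epsilon> < norm y" by simp
      then have "\<epsilon> * norm y < norm y * norm y"
        using \<open>\<epsilon> > 0\<close> by (intro mult_strict_right_mono) linarith+
      moreover have "\<epsilon> * \<epsilon> < norm y * norm y"
        using \<open>\<epsilon> < norm y\<close> \<open>\<epsilon> > 0\<close> by (intro mult_strict_mono) linarith+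
      ultimately show False
        using le by (simp add: power2_eq_square)
    qed
    then show ?thesis
      by (simp add: y_def w_def blinfun.diff_left blinfun.diff_right)
  qed
  then have "norm (K - (K o\<^sub>L p U)) \<le> \<epsilon>"
    unfolding norm_blinfun_eq_SUP_cball by (intro cSUP_least) auto
  with U show ?thesis by blast
qed

text \<open>Two one-sided approximations are merged by passing to the union of their small sets;
  neither error grows under this enlargement.\<close>

lemma small_approx_compact:
  assumes K: "K \<in> compact_operators" and "\<epsilon> > 0"
  shows "\<exists>U. small U \<and> norm (K - (p U o\<^sub>L K o\<^sub>L p U)) \<le> \<epsilon>"
proof -
  obtain U V where U: "small U" "norm (K - (p U o\<^sub>L K)) \<le> \<epsilon>/2"
    and V: "small V" "norm (K - (K o\<^sub>L p V)) \<le> \<epsilon>/2"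
    using small_approx_compact_left[OF K, of "\<epsilon>/2"] small_approx_compact_right[OF K, of "\<epsilon>/2"]
      \<open>\<epsilon> > 0\<close> by auto
  define W where "W = U \<union> V"
  have W: "small W" "W \<in> \<AA>" "U \<in> \<AA>" "V \<in> \<AA>"
    unfolding W_def using U V small_Un small_measurable by blast+
  have norm_compl: "norm (id_blinfun - p W) \<le> 1"
    by (rule norm_blinfun_bound)
      (simp_all add: blinfun.diff_left is_projection_norm_le[OF projection[OF W(2)]])
  have UW: "p W (p U x) = p U x" and VW: "p V (p W x) = p V x" for x
    using W by (simp_all add: p_p W_def inf.absorb2 inf.absorb1)
  \<comment> \<open>\<open>p W\<close> fixes the range of \<open>p U\<close>, so the complementary
    projection sees only the error already made with \<open>U\<close>.\<close>
  have "K - (p W o\<^sub>L K) = (id_blinfun - p W) o\<^sub>L (K - (p U o\<^sub>L K))"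
    by (rule blinfun_eqI) (simp add: blinfun.diff_left blinfun.diff_right UW)
  then have "norm (K - (p W o\<^sub>L K)) \<le> norm (id_blinfun - p W) * norm (K - (p U o\<^sub>L K))"
    by (simp only: norm_blinfun_compose)
  also have "\<dots> \<le> 1 * (\<epsilon>/2)"
    by (intro mult_mono norm_compl U) auto
  finally have left: "norm (K - (p W o\<^sub>L K)) \<le> \<epsilon>/2" by simp
  have "K - (K o\<^sub>L p W) = (K - (K o\<^sub>L p V)) o\<^sub>L (id_blinfun - p W)"
    by (rule blinfun_eqI) (simp add: blinfun.diff_left blinfun.diff_right VW)
  then have "norm (K - (K o\<^sub>L p W)) \<le> norm (K - (K o\<^sub>L p V)) * norm (id_blinfun - p W)"
    by (simp only: norm_blinfun_compose)
  also have "\<dots> \<le> \<epsilon>/2 * 1"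
    by (intro mult_mono norm_compl V) (use \<open>\<epsilon> > 0\<close> in auto)
  finally have right: "norm (K - (K o\<^sub>L p W)) \<le> \<epsilon>/2" by simp
  have "norm (p W o\<^sub>L (K - (K o\<^sub>L p W))) \<le> norm (p W) * norm (K - (K o\<^sub>L p W))"
    by (rule norm_blinfun_compose)
  also have "\<dots> \<le> 1 * (\<epsilon>/2)"
    by (intro mult_mono norm_projection_le projection W right) auto
  finally have right': "norm (p W o\<^sub>L (K - (K o\<^sub>L p W))) \<le> \<epsilon>/2" by simp
  \<comment> \<open>First cut on the left, then on the right; the second error is compressed by
    \<open>p W\<close>, a contraction.\<close>
  have "K - (p W o\<^sub>L K o\<^sub>L p W) = (K - (p W o\<^sub>L K)) + (p W o\<^sub>L (K - (K o\<^sub>L p W)))"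
    by (rule blinfun_eqI) (simp add: blinfun.diff_left blinfun.diff_right blinfun.add_left)
  then have "norm (K - (p W o\<^sub>L K o\<^sub>L p W)) \<le> \<epsilon>/2 + \<epsilon>/2"
    using norm_triangle_mono[OF left right'] by (simp only:)
  then show ?thesis
    using W(1) by auto
qed

text \<open>A small set may be unbounded, but its trace \<open>V\<close> on a single component is
  bounded. As \<open>K\<close> lives on that component, compressing it by \<open>V\<close> or by the
  small set gives the same operator, and \<open>C_Roe_corner\<close> applies.\<close>

lemma C_Roe_component_compact:
  assumes K: "K \<in> compact_operators" and i: "i \<in> I"
    and left: "\<And>x. p (Xc i) (K x) = K x" and right: "\<And>x. K (p (Xc i) x) = K x"
  shows "K \<in> C_Roe \<E> \<AA> p"
proof -
  have "K \<in> closure (C_Roe \<E> \<AA> p)"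
    unfolding closure_approachable
  proof (intro allI impI)
    fix \<epsilon> :: real assume "\<epsilon> > 0"
    then obtain U where U: "small U" "norm (K - (p U o\<^sub>L K o\<^sub>L p U)) \<le> \<epsilon>/2"
      using small_approx_compact[OF K] half_gt_zero by blast
    define V where "V = U \<inter> Xc i"
    have V: "V \<in> \<AA>" "coarse_bounded \<E> V"
      using U i measurable_component by (auto simp: V_def small_def)
    have "p V x = p U (p (Xc i) x)" "p V x = p (Xc i) (p U x)" for x
      using small_measurable[OF U(1)] measurable_component[OF i]
      by (simp_all add: p_p V_def Int_commute)
    then have "p V (K (p V x)) = p U (K (p U x))" for x
      using left right by metis
    then have "p V o\<^sub>L K o\<^sub>L p V = p U o\<^sub>L K o\<^sub>L p U"
      by (intro blinfun_eqI) simp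
    then have "dist (p V o\<^sub>L K o\<^sub>L p V) K < \<epsilon>"
      using U \<open>\<epsilon> > 0\<close> by (simp add: dist_norm norm_minus_commute)
    then show "\<exists>s\<in>C_Roe \<E> \<AA> p. dist s K < \<epsilon>"
      using C_Roe_corner[OF K V] by blast
  qed
  then show ?thesis
    by (simp add: C_Roe_def)
qed

section \<open>Norm estimates component by component\<close>

lemma norm_finite_components:
  assumes "finite G" "G \<subseteq> I"
  shows "(\<Union>i\<in>G. Xc i) \<in> \<AA> \<and> (norm (p (\<Union>i\<in>G. Xc i) z))\<^sup>2 = (\<Sum>i\<in>G. (norm (p (Xc i) z))\<^sup>2)"
  using assms
proof (induction G)
  case empty
  then show ?case by (simp add: proj_empty)
next
  case (insert j G)
  let ?U = "\<Union>i\<in>G. Xc i"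
  have j: "Xc j \<in> \<AA>" "?U \<in> \<AA>"
    using insert measurable_component by auto
  have disj: "Xc j \<inter> ?U = {}"
    using components_disjoint insert by blast
  have "p (Xc j \<union> ?U) z = p (Xc j) z + p ?U z"
    using p_Un_disjoint[OF j disj] by (simp add: blinfun.add_left)
  then have "(norm (p (Xc j \<union> ?U) z))\<^sup>2 = (norm (p (Xc j) z))\<^sup>2 + (norm (p ?U z))\<^sup>2"
    using is_projection_pythagoras[OF projection[OF j(1)], of "p (Xc j) z" "p ?U z"] j disj
    by (simp add: p_p proj_empty)
  then show ?case
    using insert j by (simp add: Un)
qed

text \<open>This replaces an infinite Pythagorean sum: up to \<open>\<delta>\<close>, the vector
  \<open>y\<close> lives on the finitely many components that meet a small set, where the squared
  norms of the components add up.\<close>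

lemma norm_le_componentwise:
  assumes le: "\<And>i. i \<in> I \<Longrightarrow> norm (p (Xc i) y) \<le> \<epsilon> * norm (p (Xc i) x)" and "0 \<le> \<epsilon>"
  shows "norm y \<le> \<epsilon> * norm x"
proof (rule field_le_epsilon)
  fix \<delta> :: real assume "\<delta> > 0"
  then obtain U where U: "small U" "norm (y - p U y) \<le> \<delta>"
    using small_approx by blast
  define G where "G = {i \<in> I. U \<inter> Xc i \<noteq> {}}"
  define W where "W = (\<Union>i\<in>G. Xc i)"
  have G: "finite G" "G \<subseteq> I"
    using U by (auto simp: G_def small_def)
  have W: "W \<in> \<AA>" and norm_W: "(norm (p W z))\<^sup>2 = (\<Sum>i\<in>G. (norm (p (Xc i) z))\<^sup>2)" for z
    unfolding W_def using norm_finite_components[OF G] by blast+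
  have "U \<in> \<AA>" using U by (simp add: small_def)
  then have "U \<subseteq> W"
    using components_cover sets_into_space unfolding W_def G_def by fast
  then have "norm (y - p W y) \<le> \<delta>"
    using p_residual_mono[OF \<open>U \<in> \<AA>\<close> W] U by (meson order_trans)
  moreover have "norm (p W y) \<le> \<epsilon> * norm x"
  proof -
    have "(norm (p W y))\<^sup>2 \<le> (\<Sum>i\<in>G. \<epsilon>\<^sup>2 * (norm (p (Xc i) x))\<^sup>2)"
      unfolding norm_W using le G
      by (intro sum_mono) (simp add: power_mult_distrib[symmetric] power_mono subset_iff)
    also have "\<dots> = \<epsilon>\<^sup>2 * (norm (p W x))\<^sup>2"
      by (simp add: norm_W sum_distrib_left)
    also have "\<dots> \<le> \<epsilon>\<^sup>2 * (norm x)\<^sup>2"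
      by (intro mult_left_mono power_mono is_projection_norm_le projection W) auto
    finally have "(norm (p W y))\<^sup>2 \<le> (\<epsilon> * norm x)\<^sup>2"
      by (simp add: power_mult_distrib)
    then show ?thesis
      using \<open>0 \<le> \<epsilon>\<close> by (simp add: power2_le_iff_abs_le)
  qed
  moreover have "norm y \<le> norm (p W y) + norm (y - p W y)"
    using norm_triangle_ineq[of "p W y" "y - p W y"] by simp
  ultimately show "norm y \<le> \<epsilon> * norm x + \<delta>"
    by linarith
qed

section \<open>The two inclusions\<close>

lemma diagonal_iff:
  "t \<in> diagonal_c0_sum_compacts I (\<lambda>i. p (Xc i)) \<longleftrightarrow>
    t \<in> bounded_operators
    \<and> (\<forall>i\<in>I. p (Xc i) o\<^sub>L t o\<^sub>L p (Xc i) = p (Xc i) o\<^sub>L t \<and> p (Xc i) o\<^sub>L t \<in> compact_operators)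
    \<and> (\<forall>\<epsilon>>0. finite {i \<in> I. \<epsilon> \<le> norm (p (Xc i) o\<^sub>L t)})"
  by (intro diagonal_c0_sum_compacts_iff projection measurable_component)

lemma compact_quasi_local_diagonal:
  assumes t: "t \<in> compact_operators" and ql: "quasi_local \<E> \<AA> p t"
  shows "t \<in> diagonal_c0_sum_compacts I (\<lambda>i. p (Xc i))"
  unfolding diagonal_iff
proof (intro conjI ballI allI impI)
  show "t \<in> bounded_operators"
    using t by (rule compact_operators_bounded)
next
  fix i assume i: "i \<in> I"
  note Xi = measurable_component[OF i]
  show "p (Xc i) o\<^sub>L t \<in> compact_operators"
    by (intro compact_operators_compose_left p_bounded Xi t)
  let ?s = "p (Xc i) o\<^sub>L t o\<^sub>L p (X - Xc i)"
  \<comment> \<open>Whatever entourage quasi-locality provides for \<open>\<epsilon>\<close>, the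
    component and its complement are separated for it; so every positive bound holds for the same
    fixed operator.\<close>
  have "norm ?s \<le> \<epsilon>" if "\<epsilon> > 0" for \<epsilon>
    using ql that Xi component_separated[OF i] unfolding quasi_local_def
    by (meson compl_sets)
  then have "?s = 0"
    using field_le_epsilon[of "norm ?s" 0] by simp
  then have "?s x = 0" for x
    by simp
  then have "p (Xc i) (t (x - p (Xc i) x)) = 0" for x
    by (simp add: p_compl[OF Xi])
  then show "p (Xc i) o\<^sub>L t o\<^sub>L p (Xc i) = p (Xc i) o\<^sub>L t"
    by (intro blinfun_eqI) (simp add: blinfun.diff_right)
next
  fix \<epsilon> :: real assume "\<epsilon> > 0"
  then obtain U where U: "small U" "norm (t - (p U o\<^sub>L t)) \<le> \<epsilon>/2"
    using small_approx_compact_left[OF t] half_gt_zero by blast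
  \<comment> \<open>On a component missed by \<open>U\<close> the projection annihilates
    \<open>p U o\<^sub>L t\<close> and only the approximation error remains; taking it to be
    \<open>\<epsilon>/2\<close> makes the inequality strict.\<close>
  have "norm (p (Xc i) o\<^sub>L t) < \<epsilon>" if i: "i \<in> I" "U \<inter> Xc i = {}" for i
  proof -
    note Xi = measurable_component[OF i(1)]
    have "p (Xc i) (p U x) = 0" for x
      using i(2) Xi small_measurable[OF U(1)] by (simp add: p_p Int_commute proj_empty)
    then have "p (Xc i) o\<^sub>L t = p (Xc i) o\<^sub>L (t - (p U o\<^sub>L t))"
      by (intro blinfun_eqI) (simp add: blinfun.diff_left blinfun.diff_right)
    then have "norm (p (Xc i) o\<^sub>L t) \<le> norm (p (Xc i)) * norm (t - (p U o\<^sub>L t))"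
      by (simp only: norm_blinfun_compose)
    also have "\<dots> \<le> 1 * (\<epsilon>/2)"
      by (intro mult_mono norm_projection_le projection Xi U) auto
    finally show ?thesis using \<open>\<epsilon> > 0\<close> by simp
  qed
  then have "{i \<in> I. \<epsilon> \<le> norm (p (Xc i) o\<^sub>L t)} \<subseteq> {i \<in> I. U \<inter> Xc i \<noteq> {}}"
    by force
  then show "finite {i \<in> I. \<epsilon> \<le> norm (p (Xc i) o\<^sub>L t)}"
    using U finite_subset by (auto simp: small_def)
qed

lemma diagonal_compact_Roe:
  assumes t: "t \<in> diagonal_c0_sum_compacts I (\<lambda>i. p (Xc i))"
  shows "t \<in> C_Roe \<E> \<AA> p \<inter> compact_operators"
proof -
  let ?R = "C_Roe \<E> \<AA> p \<inter> compact_operators"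
  have comp: "p (Xc i) o\<^sub>L t \<in> compact_operators"
    and diag': "p (Xc i) o\<^sub>L t o\<^sub>L p (Xc i) = p (Xc i) o\<^sub>L t" if "i \<in> I" for i
    using t that unfolding diagonal_iff by simp_all
  have diag: "p (Xc i) (t (p (Xc i) x)) = p (Xc i) (t x)" if "i \<in> I" for i x
    using arg_cong[OF diag'[OF that], of "\<lambda>s. s x"] by simp
  \<comment> \<open>This operator lives on one component: on the left by idempotence of the
    projection, on the right by diagonality of \<open>t\<close>.\<close>
  have single: "p (Xc i) o\<^sub>L t \<in> ?R" if i: "i \<in> I" for i
    using C_Roe_component_compact[OF comp[OF i] i] comp[OF i] diag[OF i]
      is_projection_idem[OF projection[OF measurable_component[OF i]]]
    by simp
  \<comment> \<open>Zero is the corner of itself at the empty set; it starts the induction over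
    finite sums.\<close>
  have zero: "0 \<in> ?R"
    using C_Roe_corner[of 0 "{}"] small_empty subset_closed[OF diagonal]
    by (simp add: compact_operators_zero proj_empty coarse_bounded_def)
  have sum: "(\<Sum>i\<in>F. p (Xc i) o\<^sub>L t) \<in> ?R" if "finite F" "F \<subseteq> I" for F
    using that
    by (induction F) (use zero single in \<open>auto intro!: C_Roe_add compact_operators_add\<close>)
  have "t \<in> closure ?R"
    unfolding closure_approachable
  proof (intro allI impI)
    fix \<epsilon> :: real assume "\<epsilon> > 0"
    define F where "F = {i \<in> I. \<epsilon>/2 \<le> norm (p (Xc i) o\<^sub>L t)}"
    have "\<epsilon>/2 > 0"
      using \<open>\<epsilon> > 0\<close> by simp
    then have F: "finite F" "F \<subseteq> I"
      using t unfolding diagonal_iff F_def by blast+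
    define s where "s = (\<Sum>i\<in>F. p (Xc i) o\<^sub>L t)"
    \<comment> \<open>Orthogonality of the components: \<open>s\<close> reproduces the components of
      \<open>t x\<close> with index in \<open>F\<close> and erases the others.\<close>
    have ps: "p (Xc j) (s x) = (if j \<in> F then p (Xc j) (t x) else 0)" if j: "j \<in> I" for j x
    proof -
      have "p (Xc j) (p (Xc i) (t x)) = (if i = j then p (Xc j) (t x) else 0)" if "i \<in> F" for i
        using that F j measurable_component components_disjoint[of j i]
        by (auto simp: p_p proj_empty)
      then have "p (Xc j) (s x) = (\<Sum>i\<in>F. if i = j then p (Xc j) (t x) else 0)"
        by (simp add: s_def blinfun.sum_left blinfun.sum_right)
      then show ?thesis
        using F by simp
    qed
    have "norm (s - t) \<le> \<epsilon>/2"
    proof (rule norm_blinfun_bound)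
      fix x
      show "norm ((s - t) x) \<le> \<epsilon>/2 * norm x"
      proof (rule norm_le_componentwise)
        fix i assume i: "i \<in> I"
        show "norm (p (Xc i) ((s - t) x)) \<le> \<epsilon>/2 * norm (p (Xc i) x)"
        proof (cases "i \<in> F")
          case True
          then show ?thesis
            using \<open>\<epsilon> > 0\<close> i by (simp add: blinfun.diff_left blinfun.diff_right ps)
        next
          case False
          \<comment> \<open>Off \<open>F\<close> the whole component of \<open>t x\<close> is lost.
            Diagonality lets it be measured against the component of \<open>x\<close>, as the
            componentwise criterion requires, and the definition of \<open>F\<close> bounds the
            factor.\<close>
          have "norm (p (Xc i) ((s - t) x)) = norm ((p (Xc i) o\<^sub>L t) (p (Xc i) x))"
            using False i by (simp add: blinfun.diff_left blinfun.diff_right ps diag)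
          also have "\<dots> \<le> norm (p (Xc i) o\<^sub>L t) * norm (p (Xc i) x)"
            by (rule norm_blinfun)
          also have "\<dots> \<le> \<epsilon>/2 * norm (p (Xc i) x)"
            using False i by (intro mult_right_mono) (auto simp: F_def)
          finally show ?thesis .
        qed
      qed (use \<open>\<epsilon> > 0\<close> in auto)
    qed (use \<open>\<epsilon> > 0\<close> in auto)
    then have "dist s t < \<epsilon>"
      using \<open>\<epsilon> > 0\<close> by (simp add: dist_norm)
    then show "\<exists>s\<in>?R. dist s t < \<epsilon>"
      using sum[OF F] unfolding s_def by blast
  qed
  moreover have "closed ?R"
    unfolding C_Roe_def by (intro closed_Int closed_closure closed_compact_operators)
  ultimately show ?thesis
    by (simp add: closure_closed)
qed

end

theorem corollary6p18:
  fixes X :: "'x set" and \<E> :: "('x \<times> 'x) set set" and \<AA> :: "'x set set"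
    and p :: "'x set \<Rightarrow> 'h::complex_hilbert_space \<Rightarrow>\<^sub>L 'h"
    and I :: "'i set" and Xc :: "'i \<Rightarrow> 'x set"
  assumes "coarse_space X \<E>"
    and "coarse_components X \<E> I Xc"
    and "coarse_module X \<E> \<AA> p"
    and "\<And>i. i \<in> I \<Longrightarrow> Xc i \<in> \<AA>"
  shows "C_Roe \<E> \<AA> p \<inter> compact_operators = diagonal_c0_sum_compacts I (\<lambda>i. p (Xc i))
    \<and> C_cp \<E> \<AA> p \<inter> compact_operators = diagonal_c0_sum_compacts I (\<lambda>i. p (Xc i))
    \<and> (admissible X \<E> \<AA> \<longrightarrow>
         C_ql \<E> \<AA> p \<inter> compact_operators = diagonal_c0_sum_compacts I (\<lambda>i. p (Xc i)))"
proof -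
  interpret coarse_module_components X \<E> \<AA> p I Xc
    using assms by (intro coarse_module_components.intro coarse_module_components_axioms.intro)
  let ?D = "diagonal_c0_sum_compacts I (\<lambda>i. p (Xc i))"
  have "C_ql \<E> \<AA> p \<inter> compact_operators \<subseteq> ?D"
    using compact_quasi_local_diagonal by (auto simp: C_ql_def)
  moreover have "?D \<subseteq> C_Roe \<E> \<AA> p \<inter> compact_operators"
    using diagonal_compact_Roe by blast
  ultimately show ?thesis
    using C_Roe_subset_C_cp C_cp_subset_C_ql by blast
qed

end
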